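(* Let $(X,g)$ be a Riemannian submanifold of $\mathbb{R}^n$ of dimension $m$. Assume that $X\subseteq\mathbb{R}^n$ is a definable set in some o-minimal expansion $\mathcal{R}$ of the real field, in a countable language, and that $\mathcal{R}$ also defines (without parameters) the relation $d(x,y)<1$ for $x,y\in X$, where $d=d_g: X\times X\to\mathbb{R}$ is the geodesic distance. Then thickness is definable in $\mathcal{R}$ (with respect to $(X,d)$). Moreover, if $\mu$ is a probability measure on $X$ equivalent to the $g$-induced volume measure $V_g$ on $X$ (that is, $\mu(A)>0$ iff $V_g(A)>0$ for every Borel subset $A\subseteq X$), then $\mu$ is compatible with $\mathcal{R}$.
   Context: Standing assumptions: $(X,d)$ is a separable metric space without isolated points (in particular the geodesic distance is finite, so $X$ is connected). An o-minimal expansion of the real field is a structure $(\mathbb{R},+,\cdot,0,1,<,\ldots)$ in which every definable (with parameters) subset of $\mathbb{R}$ is a finite union of points and open intervals with endpoints in $\mathbb{R}\cup\{\pm\infty\}$. For a formula $\varphi(x,y)$ with $|x|=n$, put $\varphi(X,\bar b)=\{x\in X:\mathcal{R}\models\varphi(x,\bar b)\}$. A definable subset $A\subseteq X$ is thick if it contains a non-empty open ball of $(X,d)$; otherwise it is thin. Thickness is definable in $\mathcal{R}$ if for every formula $\varphi(x,y)$ without parameters, with $|x|=n$ and $|y|=kn$, there is a formula $\psi(y)$ without parameters such that for every $\bar b\in X^k$: $\mathcal{R}\models\psi(\bar b)$ iff $\varphi(X,\bar b)$ is thick. A ($\sigma$-additive) probability measure $\mu$ on $X$ is compatible with $\mathcal{R}$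 if for all $k\in\mathbb{N}$ every definable subset of $X^k$ is $\mu^k$-measurable ($\mu^k$ the product measure), and for every definable $D\subseteq X$, $\mu(D)=0$ iff $D$ does not contain any non-empty open ball. *)

theory Defs
  imports "HOL-Probability.Probability"
begin

section \<open>First-order structures expanding the ordered real field\<close>

text \<open>The symbols \<open>+, \<cdot>, 0, 1, <\<close> of the real field are built into the syntax and always have
  their standard meaning; a language lists only the additional symbols. Hence every
  \<open>real_structure\<close> is an expansion of the real field.\<close>

datatype 'f trm =
    Var nat
  | Zero
  | One
  | Add "'f trm" "'f trm"
  | Mul "'f trm" "'f trm"
  | App 'f "'f trm list"

datatype ('f, 'r) fm =
    Equal "'f trm" "'f trm"
  | Less "'f trm" "'f trm"
  | Rel 'r "'f trm list"
  | Neg "('f, 'r) fm"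
  | Conj "('f, 'r) fm" "('f, 'r) fm"
  | Exists nat "('f, 'r) fm"

record ('f, 'r) real_structure =
  fun_syms :: "'f set"
  rel_syms :: "'r set"
  fun_arity :: "'f \<Rightarrow> nat"
  rel_arity :: "'r \<Rightarrow> nat"
  fun_interp :: "'f \<Rightarrow> real list \<Rightarrow> real"
  rel_interp :: "'r \<Rightarrow> real list \<Rightarrow> bool"

definition countable_language :: "('f, 'r) real_structure \<Rightarrow> bool" where
  "countable_language M \<longleftrightarrow> countable (fun_syms M) \<and> countable (rel_syms M)"

primrec wf_trm :: "('f, 'r) real_structure \<Rightarrow> 'f trm \<Rightarrow> bool" where
  "wf_trm M (Var v) \<longleftrightarrow> True"
| "wf_trm M Zero \<longleftrightarrow> True"
| "wf_trm M One \<longleftrightarrow> True"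
| "wf_trm M (Add s t) \<longleftrightarrow> wf_trm M s \<and> wf_trm M t"
| "wf_trm M (Mul s t) \<longleftrightarrow> wf_trm M s \<and> wf_trm M t"
| "wf_trm M (App f ts) \<longleftrightarrow>
     f \<in> fun_syms M \<and> length ts = fun_arity M f \<and> list_all id (map (wf_trm M) ts)"

primrec wf_fm :: "('f, 'r) real_structure \<Rightarrow> ('f, 'r) fm \<Rightarrow> bool" where
  "wf_fm M (Equal s t) \<longleftrightarrow> wf_trm M s \<and> wf_trm M t"
| "wf_fm M (Less s t) \<longleftrightarrow> wf_trm M s \<and> wf_trm M t"
| "wf_fm M (Rel r ts) \<longleftrightarrow>
     r \<in> rel_syms M \<and> length ts = rel_arity M r \<and> list_all (wf_trm M) ts"
| "wf_fm M (Neg p) \<longleftrightarrow> wf_fm M p"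
| "wf_fm M (Conj p q) \<longleftrightarrow> wf_fm M p \<and> wf_fm M q"
| "wf_fm M (Exists v p) \<longleftrightarrow> wf_fm M p"

primrec fv_trm :: "'f trm \<Rightarrow> nat set" where
  "fv_trm (Var v) = {v}"
| "fv_trm Zero = {}"
| "fv_trm One = {}"
| "fv_trm (Add s t) = fv_trm s \<union> fv_trm t"
| "fv_trm (Mul s t) = fv_trm s \<union> fv_trm t"
| "fv_trm (App f ts) = \<Union> (set (map fv_trm ts))"

primrec fv_fm :: "('f, 'r) fm \<Rightarrow> nat set" where
  "fv_fm (Equal s t) = fv_trm s \<union> fv_trm t"
| "fv_fm (Less s t) = fv_trm s \<union> fv_trm t"
| "fv_fm (Rel r ts) = \<Union> (fv_trm ` set ts)"
| "fv_fm (Neg p) = fv_fm p"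
| "fv_fm (Conj p q) = fv_fm p \<union> fv_fm q"
| "fv_fm (Exists v p) = fv_fm p - {v}"

primrec val :: "('f, 'r) real_structure \<Rightarrow> (nat \<Rightarrow> real) \<Rightarrow> 'f trm \<Rightarrow> real" where
  "val M e (Var v) = e v"
| "val M e Zero = 0"
| "val M e One = 1"
| "val M e (Add s t) = val M e s + val M e t"
| "val M e (Mul s t) = val M e s * val M e t"
| "val M e (App f ts) = fun_interp M f (map (val M e) ts)"

primrec sat :: "('f, 'r) real_structure \<Rightarrow> (nat \<Rightarrow> real) \<Rightarrow> ('f, 'r) fm \<Rightarrow> bool" where
  "sat M e (Equal s t) \<longleftrightarrow> val M e s = val M e t"
| "sat M e (Less s t) \<longleftrightarrow> val M e s < val M e t"
| "sat M e (Rel r ts) \<longleftrightarrow> rel_interp M r (map (val M e) ts)"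
| "sat M e (Neg p) \<longleftrightarrow> \<not> sat M e p"
| "sat M e (Conj p q) \<longleftrightarrow> sat M e p \<and> sat M e q"
| "sat M e (Exists v p) \<longleftrightarrow> (\<exists>a. sat M (e(v := a)) p)"

text \<open>The assignment \<open>e\<close> supplies the real parameters.\<close>

definition o_minimal :: "('f, 'r) real_structure \<Rightarrow> bool" where
  "o_minimal M \<longleftrightarrow>
     (\<forall>p e v. wf_fm M p \<longrightarrow>
        (\<exists>F. finite F \<and> {a. sat M (e(v := a)) p} = \<Union> F \<and>
             (\<forall>I\<in>F. (\<exists>a. I = {a}) \<or>
                    (\<exists>a b :: ereal. I = {x. a < ereal x \<and> ereal x < b}))))"


section \<open>Definable sets of tuples of points of Euclidean space\<close>

text \<open>A \<open>k\<close>-tuple of points of \<open>\<real>\<^sup>n\<close> is a function \<open>c\<close> on \<open>{..<k}\<close>. It is read as the assignment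
  giving the variables \<open>i * n, \<dots>, i * n + (n - 1)\<close> the coordinates of \<open>c i\<close>, with the finite
  index type enumerated by \<^const>\<open>from_nat_into\<close>. The choice of enumeration is
  irrelevant, since variables of formulas may be permuted.\<close>

definition coords :: "(nat \<Rightarrow> real ^ 'n::finite) \<Rightarrow> nat \<Rightarrow> real" where
  "coords c v = c (v div CARD('n)) $ from_nat_into (UNIV :: 'n set) (v mod CARD('n))"

definition definable ::
    "('f, 'r) real_structure \<Rightarrow> nat \<Rightarrow> (nat \<Rightarrow> real ^ 'n::finite) set \<Rightarrow> bool" where
  "definable M k D \<longleftrightarrow>
     (\<exists>p b. wf_fm M p \<and>
        D = {c \<in> {..<k} \<rightarrow>\<^sub>E UNIV. sat M (\<lambda>v. if v < k * CARD('n) then coords c v else b v) p})"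

definition definable_without_parameters ::
    "('f, 'r) real_structure \<Rightarrow> nat \<Rightarrow> (nat \<Rightarrow> real ^ 'n::finite) set \<Rightarrow> bool" where
  "definable_without_parameters M k D \<longleftrightarrow>
     (\<exists>p. wf_fm M p \<and> fv_fm p \<subseteq> {..<k * CARD('n)} \<and>
        D = {c \<in> {..<k} \<rightarrow>\<^sub>E UNIV. sat M (coords c) p})"

definition definable_set :: "('f, 'r) real_structure \<Rightarrow> (real ^ 'n::finite) set \<Rightarrow> bool" where
  "definable_set M D \<longleftrightarrow> definable M 1 ({..<1} \<rightarrow>\<^sub>E D)"


section \<open>Thickness and compatible measures\<close>

definition separable_metric_no_isolated :: "'a set \<Rightarrow> ('a \<Rightarrow> 'a \<Rightarrow> real) \<Rightarrow> bool" where
  "separable_metric_no_isolated X d \<longleftrightarrow>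
     Metric_space X d \<and>
     separable_space (Metric_space.mtopology X d) \<and>
     X \<subseteq> (Metric_space.mtopology X d) derived_set_of X"

definition thick :: "'a set \<Rightarrow> ('a \<Rightarrow> 'a \<Rightarrow> real) \<Rightarrow> 'a set \<Rightarrow> bool" where
  "thick X d A \<longleftrightarrow>
     (\<exists>x r. Metric_space.mball X d x r \<noteq> {} \<and> Metric_space.mball X d x r \<subseteq> A)"

text \<open>In \<open>\<phi>(x, y)\<close> the variables \<open>x\<close> are \<open>0, \<dots>, n - 1\<close> and the variables \<open>y\<close> are the next
  \<open>k * n\<close> ones; in \<open>\<psi>(y)\<close> the variables \<open>y\<close> are renumbered starting from \<open>0\<close>.\<close>

definition thickness_definable ::
    "('f, 'r) real_structure \<Rightarrow> (real ^ 'n::finite) set \<Rightarrow> (real ^ 'n \<Rightarrow> real ^ 'n \<Rightarrow> real) \<Rightarrow> bool"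
  where
  "thickness_definable M X d \<longleftrightarrow>
     (\<forall>k \<phi>. wf_fm M \<phi> \<and> fv_fm \<phi> \<subseteq> {..<(1 + k) * CARD('n)} \<longrightarrow>
        (\<exists>\<psi>. wf_fm M \<psi> \<and> fv_fm \<psi> \<subseteq> {..<k * CARD('n)} \<and>
           (\<forall>b \<in> {..<k} \<rightarrow>\<^sub>E X.
              sat M (coords b) \<psi> \<longleftrightarrow> thick X d {x \<in> X. sat M (coords (case_nat x b)) \<phi>})))"

definition compatible ::
    "('f, 'r) real_structure \<Rightarrow> (real ^ 'n::finite) set \<Rightarrow> (real ^ 'n \<Rightarrow> real ^ 'n \<Rightarrow> real) \<Rightarrow>
     (real ^ 'n) measure \<Rightarrow> bool" where
  "compatible M X d \<mu> \<longleftrightarrow>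
     (\<forall>k D. D \<subseteq> ({..<k} \<rightarrow>\<^sub>E X) \<and> definable M k D \<longrightarrow> D \<in> sets (Pi\<^sub>M {..<k} (\<lambda>_. \<mu>))) \<and>
     (\<forall>D. D \<subseteq> X \<and> definable_set M D \<longrightarrow> (measure \<mu> D = 0 \<longleftrightarrow> \<not> thick X d D))"


section \<open>Riemannian submanifolds of Euclidean space\<close>

text \<open>For open \<open>U\<close>, \<open>Ck_on k U f\<close> says that \<open>f\<close> is of class \<open>C\<^sup>k\<close> on \<open>U\<close>.\<close>

primrec Ck_on ::
    "nat \<Rightarrow> 'a::euclidean_space set \<Rightarrow> ('a \<Rightarrow> 'b::real_normed_vector) \<Rightarrow> bool" where
  "Ck_on 0 U f \<longleftrightarrow> continuous_on U f"
| "Ck_on (Suc k) U f \<longleftrightarrow>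
     (\<forall>x\<in>U. f differentiable (at x)) \<and>
     (\<forall>v. Ck_on k U (\<lambda>x. frechet_derivative f (at x) v))"

definition smooth_on ::
    "'a::euclidean_space set \<Rightarrow> ('a \<Rightarrow> 'b::real_normed_vector) \<Rightarrow> bool" where
  "smooth_on U f \<longleftrightarrow> (\<forall>k. Ck_on k U f)"

definition local_parametrization ::
    "(real ^ 'n::finite) set \<Rightarrow> (real ^ 'm::finite) set \<Rightarrow> (real ^ 'm \<Rightarrow> real ^ 'n) \<Rightarrow> bool" where
  "local_parametrization X U \<phi> \<longleftrightarrow>
     open U \<and> smooth_on U \<phi> \<and>
     (\<forall>u\<in>U. inj (frechet_derivative \<phi> (at u))) \<and>
     openin (top_of_set X) (\<phi> ` U) \<and>
     (\<exists>\<psi>. homeomorphism U (\<phi> ` U) \<phi> \<psi>)"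

text \<open>The dimension is \<open>CARD('m)\<close>.\<close>

definition embedded_submanifold ::
    "'m::finite itself \<Rightarrow> (real ^ 'n::finite) set \<Rightarrow> bool" where
  "embedded_submanifold m X \<longleftrightarrow>
     (\<forall>x\<in>X. \<exists>U (\<phi> :: real ^ 'm \<Rightarrow> real ^ 'n). local_parametrization X U \<phi> \<and> x \<in> \<phi> ` U)"

text \<open>\<open>g x u v\<close> is the value of the metric at \<open>x \<in> X\<close> on tangent vectors \<open>u, v\<close>; it is relevant
  only for \<open>u, v\<close> in the tangent space at \<open>x\<close>, which is the range of the derivative
  of any local parametrization. The metric induced by \<open>\<real>\<^sup>n\<close> is \<open>\<lambda>x u v. u \<bullet> v\<close>.\<close>

definition pullback_metric ::
    "(real ^ 'n \<Rightarrow> real ^ 'n \<Rightarrow> real ^ 'n::finite \<Rightarrow> real) \<Rightarrow> (real ^ 'm::finite \<Rightarrow> real ^ 'n) \<Rightarrow>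
     real ^ 'm \<Rightarrow> real ^ 'm \<Rightarrow> real ^ 'm \<Rightarrow> real" where
  "pullback_metric g \<phi> u \<xi> \<eta> =
     g (\<phi> u) (frechet_derivative \<phi> (at u) \<xi>) (frechet_derivative \<phi> (at u) \<eta>)"

definition riemannian_metric ::
    "'m::finite itself \<Rightarrow> (real ^ 'n::finite) set \<Rightarrow>
     (real ^ 'n \<Rightarrow> real ^ 'n \<Rightarrow> real ^ 'n \<Rightarrow> real) \<Rightarrow> bool" where
  "riemannian_metric m X g \<longleftrightarrow>
     (\<forall>U (\<phi> :: real ^ 'm \<Rightarrow> real ^ 'n). local_parametrization X U \<phi> \<longrightarrow>
        (\<forall>u\<in>U. bilinear (pullback_metric g \<phi> u) \<and>
           (\<forall>\<xi> \<eta>. pullback_metric g \<phi> u \<xi> \<eta> = pullback_metric g \<phi> u \<eta> \<xi>) \<and>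
           (\<forall>\<xi>. \<xi> \<noteq> 0 \<longrightarrow> pullback_metric g \<phi> u \<xi> \<xi> > 0)) \<and>
        (\<forall>\<xi> \<eta>. smooth_on U (\<lambda>u. pullback_metric g \<phi> u \<xi> \<eta>)))"

definition riemannian_submanifold ::
    "'m::finite itself \<Rightarrow> (real ^ 'n::finite) set \<Rightarrow>
     (real ^ 'n \<Rightarrow> real ^ 'n \<Rightarrow> real ^ 'n \<Rightarrow> real) \<Rightarrow> bool" where
  "riemannian_submanifold m X g \<longleftrightarrow> embedded_submanifold m X \<and> riemannian_metric m X g"

text \<open>The length is taken in \<open>ennreal\<close> because \<^const>\<open>valid_path\<close> does not bound the
  derivative near its finitely many exceptional parameters; such curves may have length
  \<open>\<infinity>\<close>, and then do not affect the infimum.\<close>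

definition curve_length ::
    "(real ^ 'n \<Rightarrow> real ^ 'n \<Rightarrow> real ^ 'n::finite \<Rightarrow> real) \<Rightarrow> (real \<Rightarrow> real ^ 'n) \<Rightarrow> ennreal" where
  "curve_length g \<gamma> =
     (\<integral>\<^sup>+ t \<in> {0..1}. ennreal (sqrt (g (\<gamma> t) (vector_derivative \<gamma> (at t))
                                        (vector_derivative \<gamma> (at t)))) \<partial>lborel)"

definition geodesic_edist ::
    "(real ^ 'n::finite) set \<Rightarrow> (real ^ 'n \<Rightarrow> real ^ 'n \<Rightarrow> real ^ 'n \<Rightarrow> real) \<Rightarrow>
     real ^ 'n \<Rightarrow> real ^ 'n \<Rightarrow> ennreal" where
  "geodesic_edist X g x y =
     (INF \<gamma> \<in> {\<gamma>. valid_path \<gamma> \<and> path_image \<gamma> \<subseteq> X \<and> pathstart \<gamma> = x \<and> pathfinish \<gamma> = y}.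
        curve_length g \<gamma>)"

definition geodesic_dist ::
    "(real ^ 'n::finite) set \<Rightarrow> (real ^ 'n \<Rightarrow> real ^ 'n \<Rightarrow> real ^ 'n \<Rightarrow> real) \<Rightarrow>
     real ^ 'n \<Rightarrow> real ^ 'n \<Rightarrow> real" where
  "geodesic_dist X g x y = enn2real (geodesic_edist X g x y)"

text \<open>The Riemannian volume is the unique Borel measure on \<open>X\<close> with density
  \<open>sqrt (det (g\<^sub>i\<^sub>j))\<close> with respect to Lebesgue measure in every local parametrization.\<close>

definition riemannian_volume ::
    "'m::finite itself \<Rightarrow> (real ^ 'n::finite) set \<Rightarrow>
     (real ^ 'n \<Rightarrow> real ^ 'n \<Rightarrow> real ^ 'n \<Rightarrow> real) \<Rightarrow> (real ^ 'n) measure \<Rightarrow> bool" where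
  "riemannian_volume m X g V \<longleftrightarrow>
     sets V = sets (restrict_space borel X) \<and>
     (\<forall>U (\<phi> :: real ^ 'm \<Rightarrow> real ^ 'n) A.
        local_parametrization X U \<phi> \<and> A \<in> sets V \<and> A \<subseteq> \<phi> ` U \<longrightarrow>
        emeasure V A =
          (\<integral>\<^sup>+ u \<in> U \<inter> \<phi> -` A.
             ennreal (sqrt (det (\<chi> i j. pullback_metric g \<phi> u (axis i 1) (axis j 1)))) \<partial>lborel))"

end

theory Submission
  imports Defs
begin

text \<open>The geodesic topology is the Euclidean subspace topology: a short chart segment bounds \<open>d\<close>
  from above, and a curve leaving a chart ball has length bounded below because its velocity is
  tangent to \<open>X\<close>. So \<open>A \<subseteq> X\<close> is thick iff it contains \<open>X \<inter> B\<close> for a coordinate box \<open>B\<close> meeting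
  \<open>X\<close>, which is first-order; \<open>X = {x. d x x < 1}\<close> is definable without parameters.

  No cell decomposition is needed. A fibre of a definable set over its last coordinate is the
  union of its rational subintervals and of a finite set, which is closed; both are described by
  definable conditions with rational parameters on the remaining coordinates, so definable sets
  are Borel by induction on the dimension. If a definable subset of \<open>\<real>\<^sup>m\<close> has positive measure, then
  for some rational \<open>q < r\<close> the points whose fibre contains the interval from \<open>q\<close> to \<open>r\<close> have
  positive measure, so by Fubini and induction the set contains a box.

  Near a point of \<open>X\<close> a left inverse \<open>L\<close> of the derivative of a chart is a linear, hence
  definable, bi-Lipschitz map of \<open>X\<close> to \<open>\<real>\<^sup>m\<close>; it maps a thin definable set to a definable set with
  empty interior, hence to a null set, and the chart preimage is null as a Lipschitz image of it.\<close>

section \<open>Definable predicates on assignments\<close>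

text \<open>The charts are merely smooth and need not be definable, so definable sets cannot be
  analysed in chart coordinates; hence the linear maps \<open>L\<close>, with charts used only to
  compare sets and volumes. Small geodesic balls need not be definable either, which is why
  thickness is tested on coordinate boxes, whose corners can be quantified. Two notions of
  definability run side by side. The formula \<psi> must be free of parameters, although X itself is
  assumed definable only with them. The measure-theoretic induction and the maps \<open>L\<close>
  bring in real constants, so there parameters are allowed. Both notions are handled as classes of
  predicates on assignments that are closed under connectives and quantifiers: new definable
  conditions are written as HOL predicates, and syntax is touched only at the borders. o-minimality
  enters through a single consequence, \<open>param_pred_fibre_finite\<close>: a definable subset of
  the line differs from its interior by a finite set.\<close>

lemma finite_fv_trm: "finite (fv_trm t)"
  by (induction t) auto

lemma finite_fv_fm: "finite (fv_fm p)"
  by (induction p) (auto simp: finite_fv_trm)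

lemma val_cong:
  assumes "\<And>v. v \<in> fv_trm t \<Longrightarrow> e v = e' v"
  shows "val M e t = val M e' t"
  using assms
proof (induction t)
  case (App f ts)
  have "map (val M e) ts = map (val M e') ts"
    by (rule map_cong[OF refl], rule App.IH) (use App.prems in auto)
  then show ?case by (simp only: val.simps)
qed auto

lemma sat_cong:
  assumes "\<And>v. v \<in> fv_fm p \<Longrightarrow> e v = e' v"
  shows "sat M e p = sat M e' p"
  using assms
proof (induction p arbitrary: e e')
  case (Equal s t)
  then have "val M e s = val M e' s" "val M e t = val M e' t" by (auto intro!: val_cong)
  then show ?case by simp
next
  case (Less s t)
  then have "val M e s = val M e' s" "val M e t = val M e' t" by (auto intro!: val_cong)
  then show ?case by simp
next
  case (Rel r ts)
  have "map (val M e) ts = map (val M e') ts"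
    by (rule map_cong[OF refl], rule val_cong) (use Rel.prems in auto)
  then show ?case by (simp only: sat.simps)
next
  case (Neg p)
  from Neg.IH[of e e'] Neg.prems show ?case by simp
next
  case (Conj p q)
  from Conj.IH(1)[of e e'] Conj.IH(2)[of e e'] Conj.prems show ?case by simp
next
  case (Exists w p)
  have "sat M (e(w := a)) p = sat M (e'(w := a)) p" for a
    by (rule Exists.IH) (use Exists.prems in auto)
  then show ?case by simp
qed

section \<open>Injective renaming of variables\<close>

primrec rename_trm :: "(nat \<Rightarrow> nat) \<Rightarrow> 'f trm \<Rightarrow> 'f trm" where
  "rename_trm \<sigma> (Var v) = Var (\<sigma> v)"
| "rename_trm \<sigma> Zero = Zero"
| "rename_trm \<sigma> One = One"
| "rename_trm \<sigma> (Add s t) = Add (rename_trm \<sigma> s) (rename_trm \<sigma> t)"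
| "rename_trm \<sigma> (Mul s t) = Mul (rename_trm \<sigma> s) (rename_trm \<sigma> t)"
| "rename_trm \<sigma> (App f ts) = App f (map (rename_trm \<sigma>) ts)"

text \<open>Bound variables are renamed together with free ones. For an injective \<sigma> this
  cannot cause capture, so no fresh names have to be chosen.\<close>

primrec rename_fm :: "(nat \<Rightarrow> nat) \<Rightarrow> ('f, 'r) fm \<Rightarrow> ('f, 'r) fm" where
  "rename_fm \<sigma> (Equal s t) = Equal (rename_trm \<sigma> s) (rename_trm \<sigma> t)"
| "rename_fm \<sigma> (Less s t) = Less (rename_trm \<sigma> s) (rename_trm \<sigma> t)"
| "rename_fm \<sigma> (Rel r ts) = Rel r (map (rename_trm \<sigma>) ts)"
| "rename_fm \<sigma> (Neg p) = Neg (rename_fm \<sigma> p)"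
| "rename_fm \<sigma> (Conj p q) = Conj (rename_fm \<sigma> p) (rename_fm \<sigma> q)"
| "rename_fm \<sigma> (Exists v p) = Exists (\<sigma> v) (rename_fm \<sigma> p)"

lemma wf_rename_trm: "wf_trm M t \<Longrightarrow> wf_trm M (rename_trm \<sigma> t)"
  by (induction t) (auto simp: list_all_iff)

lemma wf_rename_fm: "wf_fm M p \<Longrightarrow> wf_fm M (rename_fm \<sigma> p)"
  by (induction p) (auto simp: list_all_iff wf_rename_trm)

lemma val_rename_trm: "val M e (rename_trm \<sigma> t) = val M (e \<circ> \<sigma>) t"
proof (induction t)
  case (App f ts)
  have "map (val M e) (map (rename_trm \<sigma>) ts) = map (val M (e \<circ> \<sigma>)) ts"
    unfolding map_map o_def[of "val M e"] by (rule map_cong[OF refl], rule App.IH)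
  then show ?case by (simp only: val.simps rename_trm.simps)
qed auto

lemma sat_rename_fm:
  assumes "inj \<sigma>"
  shows "sat M e (rename_fm \<sigma> p) = sat M (e \<circ> \<sigma>) p"
proof (induction p arbitrary: e)
  case (Rel r ts)
  have "map (val M e) (map (rename_trm \<sigma>) ts) = map (val M (e \<circ> \<sigma>)) ts"
    by (simp add: val_rename_trm)
  then show ?case by (simp only: sat.simps rename_fm.simps)
next
  case (Exists v p)
  have "(e(\<sigma> v := a)) \<circ> \<sigma> = (e \<circ> \<sigma>)(v := a)" for a
    using assms by (auto simp: fun_eq_iff inj_eq)
  then show ?case by (simp only: sat.simps rename_fm.simps Exists)
qed (auto simp: val_rename_trm)

text \<open>The closure arguments are the same with and without parameters, so they are made once
  here and interpreted for \<open>formula_pred\<close> and \<open>param_pred\<close>. Predicates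
  take total assignments, which makes substitution a function update.\<close>

locale definability_class =
  fixes \<C> :: "((nat \<Rightarrow> real) \<Rightarrow> bool) \<Rightarrow> bool"
  assumes less: "\<C> (\<lambda>e. e i < e j)"
    and neg: "\<C> P \<Longrightarrow> \<C> (\<lambda>e. \<not> P e)"
    and conj: "\<C> P \<Longrightarrow> \<C> Q \<Longrightarrow> \<C> (\<lambda>e. P e \<and> Q e)"
    and ex: "\<C> P \<Longrightarrow> \<C> (\<lambda>e. \<exists>a. P (e(v := a)))"
begin

lemma imp: "\<C> P \<Longrightarrow> \<C> Q \<Longrightarrow> \<C> (\<lambda>e. P e \<longrightarrow> Q e)"
  using neg[OF conj[OF _ neg], of P Q] by simp

lemma all: "\<C> P \<Longrightarrow> \<C> (\<lambda>e. \<forall>a. P (e(v := a)))"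
  using neg[OF ex[OF neg], of P v] by simp

lemma ball:
  assumes "finite I" "\<And>i. i \<in> I \<Longrightarrow> \<C> (P i)"
  shows "\<C> (\<lambda>e. \<forall>i\<in>I. P i e)"
  using assms
proof (induction I)
  case empty
  show ?case using neg[OF less[of 0 0]] by simp
next
  case (insert i I)
  then show ?case using conj[of "P i" "\<lambda>e. \<forall>i\<in>I. P i e"] by simp
qed

text \<open>One HOL function \<open>f\<close> carries the values of a whole block of variables; this
  is how quantifiers over points of Euclidean space are expressed later.\<close>

lemma ex_block:
  assumes "finite B" "\<C> P"
  shows "\<C> (\<lambda>e. \<exists>f. P (\<lambda>v. if v \<in> B then f v else e v))"
  using assms
proof (induction B)
  case empty
  then show ?case by simp
next
  case (insert w B)
  have "(\<exists>f. P (\<lambda>v. if v \<in> insert w B then f v else e v)) \<longleftrightarrow>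
        (\<exists>a f. P (\<lambda>v. if v \<in> B then f v else (e(w := a)) v))" for e
  proof safe
    fix f assume "P (\<lambda>v. if v \<in> insert w B then f v else e v)"
    moreover have "(\<lambda>v. if v \<in> insert w B then f v else e v) =
        (\<lambda>v. if v \<in> B then f v else (e(w := f w)) v)" by auto
    ultimately show "\<exists>a f. P (\<lambda>v. if v \<in> B then f v else (e(w := a)) v)" by metis
  next
    fix a f assume "P (\<lambda>v. if v \<in> B then f v else (e(w := a)) v)"
    moreover have "(\<lambda>v. if v \<in> B then f v else (e(w := a)) v) =
        (\<lambda>v. if v \<in> insert w B then (f(w := a)) v else e v)" using insert.hyps by auto
    ultimately show "\<exists>f. P (\<lambda>v. if v \<in> insert w B then f v else e v)" by metis
  qed
  then show ?case using ex[OF insert.IH[OF insert.prems], of w] by simp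
qed

lemma all_block:
  assumes "finite B" "\<C> P"
  shows "\<C> (\<lambda>e. \<forall>f. P (\<lambda>v. if v \<in> B then f v else e v))"
  using neg[OF ex_block[OF assms(1) neg[OF assms(2)]]] by simp

end

section \<open>Definability without parameters, and with parameters\<close>

definition formula_pred :: "('f, 'r) real_structure \<Rightarrow> ((nat \<Rightarrow> real) \<Rightarrow> bool) \<Rightarrow> bool" where
  "formula_pred M P \<longleftrightarrow> (\<exists>p. wf_fm M p \<and> (\<forall>e. sat M e p = P e))"

lemma formula_pred_sat: "wf_fm M p \<Longrightarrow> formula_pred M (\<lambda>e. sat M e p)"
  unfolding formula_pred_def by blast

lemma formula_pred_rename:
  assumes "formula_pred M P" "inj \<sigma>"
  shows "formula_pred M (\<lambda>e. P (e \<circ> \<sigma>))"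
  using assms wf_rename_fm sat_rename_fm unfolding formula_pred_def by metis

interpretation formula_pred: definability_class "formula_pred M"
proof
  show "formula_pred M (\<lambda>e. e i < e j)" for i j
    unfolding formula_pred_def by (rule exI[of _ "Less (Var i) (Var j)"]) simp
  show "formula_pred M (\<lambda>e. \<not> P e)" if P: "formula_pred M P" for P
  proof -
    from P obtain p where "wf_fm M p" "\<forall>e. sat M e p = P e" unfolding formula_pred_def by blast
    then show ?thesis unfolding formula_pred_def by (intro exI[of _ "Neg p"]) simp
  qed
  show "formula_pred M (\<lambda>e. P e \<and> Q e)" if P: "formula_pred M P" and Q: "formula_pred M Q" for P Q
  proof -
    from P Q obtain p q where "wf_fm M p" "\<forall>e. sat M e p = P e" "wf_fm M q" "\<forall>e. sat M e q = Q e"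
      unfolding formula_pred_def by blast
    then show ?thesis unfolding formula_pred_def by (intro exI[of _ "Conj p q"]) simp
  qed
  show "formula_pred M (\<lambda>e. \<exists>a. P (e(v := a)))" if P: "formula_pred M P" for P v
  proof -
    from P obtain p where "wf_fm M p" "\<forall>e. sat M e p = P e" unfolding formula_pred_def by blast
    then show ?thesis unfolding formula_pred_def by (intro exI[of _ "Exists v p"]) simp
  qed
qed

lemma formula_pred_finite_support:
  assumes "formula_pred M P"
  shows "\<exists>N. \<forall>v\<ge>N. \<forall>e a. P (e(v := a)) = P e"
proof -
  from assms obtain p where p: "\<forall>e. sat M e p = P e" unfolding formula_pred_def by blast
  obtain N where N: "fv_fm p \<subseteq> {..<N}"
    using finite_fv_fm[of p] finite_nat_iff_bounded by blast
  have "P (e(v := a)) = P e" if "v \<ge> N" for v e a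
    using sat_cong[of p "e(v := a)" e M] p N that by force
  then show ?thesis by blast
qed

text \<open>Quantifying existentially over each unwanted variable removes it from the free variables
  and does not change the truth value, because the predicate does not depend on it.\<close>

lemma formula_pred_fv:
  assumes "formula_pred M P" and dep: "\<And>e e'. (\<And>v. v \<in> S \<Longrightarrow> e v = e' v) \<Longrightarrow> P e = P e'"
  shows "\<exists>p. wf_fm M p \<and> fv_fm p \<subseteq> S \<and> (\<forall>e. sat M e p = P e)"
proof -
  from assms obtain p where p: "wf_fm M p" "\<forall>e. sat M e p = P e" unfolding formula_pred_def by blast
  have "\<exists>q. wf_fm M q \<and> fv_fm q = fv_fm p - B \<and> (\<forall>e. sat M e q = P e)"
    if "finite B" "B \<inter> S = {}" for B
    using that
  proof (induction B)
    case empty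
    then show ?case using p by auto
  next
    case (insert w B)
    then obtain q where q: "wf_fm M q" "fv_fm q = fv_fm p - B" "\<forall>e. sat M e q = P e" by auto
    have "P (e(w := a)) = P e" for e a by (rule dep) (use insert in auto)
    then show ?case using q by (intro exI[of _ "Exists w q"]) auto
  qed
  from this[of "fv_fm p - S"] show ?thesis using finite_fv_fm[of p] by auto
qed

text \<open>Even variables carry the arguments and odd variables the parameters, so that the
  parameters of two formulas can be kept apart by an injective renaming.\<close>

definition interleave :: "(nat \<Rightarrow> real) \<Rightarrow> (nat \<Rightarrow> real) \<Rightarrow> nat \<Rightarrow> real" where
  "interleave e b v = (if even v then e (v div 2) else b (v div 2))"

definition param_pred :: "('f, 'r) real_structure \<Rightarrow> ((nat \<Rightarrow> real) \<Rightarrow> bool) \<Rightarrow> bool" where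
  "param_pred M P \<longleftrightarrow> (\<exists>Q b. formula_pred M Q \<and> P = (\<lambda>e. Q (interleave e b)))"

lemma interleave_upd: "interleave (e(v := a)) b = (interleave e b)(2 * v := a)"
  by (auto simp: interleave_def fun_eq_iff)

interpretation param_pred: definability_class "param_pred M"
proof
  show "param_pred M (\<lambda>e. e i < e j)" for i j
    unfolding param_pred_def
    by (rule exI[of _ "\<lambda>e. e (2 * i) < e (2 * j)"])
       (auto simp: interleave_def intro: formula_pred.less)
  show "param_pred M (\<lambda>e. \<not> P e)" if P: "param_pred M P" for P
    using P formula_pred.neg unfolding param_pred_def by blast
  show "param_pred M (\<lambda>e. P e \<and> Q e)" if P: "param_pred M P" and Q: "param_pred M Q" for P Q
  proof -
    from P Q obtain P' Q' b c where
      PQ: "formula_pred M P'" "P = (\<lambda>e. P' (interleave e b))"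
          "formula_pred M Q'" "Q = (\<lambda>e. Q' (interleave e c))"
      unfolding param_pred_def by blast
    \<comment> \<open>The common parameter sequence is \<open>interleave b c\<close>. There
      \<open>b k\<close> has index \<open>2 * k\<close> and \<open>c k\<close> has index
      \<open>2 * k + 1\<close>, so in the assignment they sit at variables \<open>4 * k + 1\<close>
      and \<open>4 * k + 3\<close>, that is, at \<open>2 * v - 1\<close> and
      \<open>2 * v + 1\<close> for the old variable \<open>v = 2 * k + 1\<close>.\<close>
    define \<sigma> \<tau> :: "nat \<Rightarrow> nat" where
      "\<sigma> = (\<lambda>v. if even v then v else 2 * v - 1)" and "\<tau> = (\<lambda>v. if even v then v else 2 * v + 1)"
    have inj: "inj \<sigma>" "inj \<tau>"
      unfolding \<sigma>_def \<tau>_def inj_def by (auto elim!: evenE oddE; presburger)+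
    have il: "interleave e (interleave b c) \<circ> \<sigma> = interleave e b"
             "interleave e (interleave b c) \<circ> \<tau> = interleave e c" for e
    proof -
      have "interleave e (interleave b c) (\<sigma> v) = interleave e b v"
           "interleave e (interleave b c) (\<tau> v) = interleave e c v" for v
      proof -
        have "interleave e (interleave b c) (\<sigma> v) = interleave e b v \<and>
              interleave e (interleave b c) (\<tau> v) = interleave e c v"
        proof (cases "even v")
          case True
          then show ?thesis by (simp add: \<sigma>_def \<tau>_def interleave_def)
        next
          case False
          then obtain k where v: "v = 2 * k + 1" by (rule oddE)
          have "\<sigma> v = 2 * (2 * k) + 1" "\<tau> v = 2 * (2 * k + 1) + 1" by (simp_all add: \<sigma>_def \<tau>_def v)
          moreover have "interleave e b' (2 * i + 1) = b' i" for b' i by (simp add: interleave_def)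
          ultimately show ?thesis unfolding v by (simp add: interleave_def)
        qed
        then show "interleave e (interleave b c) (\<sigma> v) = interleave e b v"
          "interleave e (interleave b c) (\<tau> v) = interleave e c v" by auto
      qed
      then show "interleave e (interleave b c) \<circ> \<sigma> = interleave e b"
                "interleave e (interleave b c) \<circ> \<tau> = interleave e c"
        by (auto simp: fun_eq_iff)
    qed
    have "formula_pred M (\<lambda>e. P' (e \<circ> \<sigma>) \<and> Q' (e \<circ> \<tau>))"
      by (intro formula_pred.conj formula_pred_rename PQ inj)
    moreover have "(\<lambda>e. P e \<and> Q e) =
        (\<lambda>e. P' (interleave e (interleave b c) \<circ> \<sigma>) \<and> Q' (interleave e (interleave b c) \<circ> \<tau>))"
      unfolding PQ il ..
    ultimately show ?thesis
      unfolding param_pred_def by (intro exI[of _ "\<lambda>e. P' (e \<circ> \<sigma>) \<and> Q' (e \<circ> \<tau>)"] exI[of _ "interleave b c"]) simp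
  qed
  show "param_pred M (\<lambda>e. \<exists>a. P (e(v := a)))" if P: "param_pred M P" for P v
  proof -
    from P obtain P' b where P': "formula_pred M P'" "P = (\<lambda>e. P' (interleave e b))"
      unfolding param_pred_def by blast
    then show ?thesis unfolding param_pred_def
      by (intro exI[of _ "\<lambda>e. \<exists>a. P' (e(2 * v := a))"] exI[of _ b])
         (simp add: interleave_upd formula_pred.ex)
  qed
qed

lemma param_pred_less_const: "param_pred M (\<lambda>e. e i < c)"
  unfolding param_pred_def
  by (intro exI[of _ "\<lambda>e. e (2 * i) < e 1"] exI[of _ "\<lambda>_. c"])
     (simp add: interleave_def formula_pred.less)

lemma param_pred_greater_const: "param_pred M (\<lambda>e. c < e i)"
  unfolding param_pred_def
  by (intro exI[of _ "\<lambda>e. e 1 < e (2 * i)"] exI[of _ "\<lambda>_. c"])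
     (simp add: interleave_def formula_pred.less)

text \<open>The coefficient \<open>c j\<close> is supplied as the parameter at variable
  \<open>2 * j + 1\<close>, so the term only adds and multiplies variables.\<close>

lemma param_pred_linear: "param_pred M (\<lambda>e. e i = (\<Sum>j<n. c j * e j))"
proof -
  have "\<exists>t. wf_trm M t \<and> (\<forall>e. val M e t = (\<Sum>j<n. e (2 * j + 1) * e (2 * j)))"
  proof (induction n)
    case 0
    then show ?case by (intro exI[of _ Zero]) simp
  next
    case (Suc n)
    then obtain t where "wf_trm M t" "\<forall>e. val M e t = (\<Sum>j<n. e (2 * j + 1) * e (2 * j))" by blast
    then show ?case
      by (intro exI[of _ "Add t (Mul (Var (2 * n + 1)) (Var (2 * n)))"]) simp
  qed
  then obtain t where t: "wf_trm M t" "\<forall>e. val M e t = (\<Sum>j<n. e (2 * j + 1) * e (2 * j))" by blast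
  then have "formula_pred M (\<lambda>e. e (2 * i) = (\<Sum>j<n. e (2 * j + 1) * e (2 * j)))"
    unfolding formula_pred_def by (intro exI[of _ "Equal (Var (2 * i)) t"]) simp
  then show ?thesis
    unfolding param_pred_def
    by (intro exI[of _ "\<lambda>e. e (2 * i) = (\<Sum>j<n. e (2 * j + 1) * e (2 * j))"] exI[of _ c])
       (simp add: interleave_def)
qed

text \<open>Bridge from the convention in \<open>definable\<close>, where parameters follow the
  arguments, to the even and odd variables of \<open>interleave\<close>.\<close>

lemma param_pred_sat:
  assumes "wf_fm M p"
  shows "param_pred M (\<lambda>e. sat M (\<lambda>v. if v < k then e v else b v) p)"
proof -
  define \<sigma> :: "nat \<Rightarrow> nat" where "\<sigma> = (\<lambda>v. if v < k then 2 * v else 2 * v + 1)"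
  have "inj \<sigma>" unfolding \<sigma>_def inj_def by (auto split: if_splits; presburger)
  then have "formula_pred M (\<lambda>e. sat M (e \<circ> \<sigma>) p)"
    by (rule formula_pred_rename[OF formula_pred_sat[OF assms]])
  moreover have "interleave e b \<circ> \<sigma> = (\<lambda>v. if v < k then e v else b v)" for e
    by (auto simp: \<sigma>_def interleave_def)
  ultimately show ?thesis
    unfolding param_pred_def by (intro exI[of _ "\<lambda>e. sat M (e \<circ> \<sigma>) p"] exI[of _ b]) simp
qed

text \<open>Provides fresh variables when the end points of an interval have to be
  quantified.\<close>

lemma param_pred_finite_support:
  assumes "param_pred M P"
  shows "\<exists>N. \<forall>v\<ge>N. \<forall>e a. P (e(v := a)) = P e"
proof -
  from assms obtain Q b where Q: "formula_pred M Q" "P = (\<lambda>e. Q (interleave e b))"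
    unfolding param_pred_def by blast
  obtain N where "\<forall>v\<ge>N. \<forall>e a. Q (e(v := a)) = Q e" using formula_pred_finite_support[OF Q(1)] by blast
  then show ?thesis unfolding Q interleave_upd by (intro exI[of _ N]) auto
qed

text \<open>In a finite union of points and open intervals, a point that is not interior cannot lie
  in one of the intervals, so it is one of the listed points.\<close>

lemma param_pred_fibre_finite:
  assumes "o_minimal M" "param_pred M P"
  shows "finite ({a. P (e(v := a))} - interior {a. P (e(v := a))})"
proof -
  from assms obtain Q b where Q: "formula_pred M Q" "P = (\<lambda>e. Q (interleave e b))"
    unfolding param_pred_def by blast
  then obtain p where p: "wf_fm M p" "\<forall>e. sat M e p = Q e" unfolding formula_pred_def by blast
  let ?S = "{a. sat M ((interleave e b)(2 * v := a)) p}"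
  obtain F where F: "finite F" "?S = \<Union> F"
    "\<And>I. I \<in> F \<Longrightarrow> (\<exists>a. I = {a}) \<or> (\<exists>a b :: ereal. I = {x. a < ereal x \<and> ereal x < b})"
    using assms(1) p(1) unfolding o_minimal_def by metis
  have "open {x. a < ereal x \<and> ereal x < b}" for a b
    by (intro open_Collect_conj open_Collect_less continuous_intros)
  then have op: "open I \<or> is_singleton I" if "I \<in> F" for I using F(3)[OF that] by (auto simp: is_singleton_def)
  have "?S - interior ?S \<subseteq> \<Union> {I \<in> F. is_singleton I}"
  proof
    fix x assume x: "x \<in> ?S - interior ?S"
    then obtain I where I: "I \<in> F" "x \<in> I" using F(2) by auto
    have "\<not> open I"
      using x I interior_maximal[of I ?S] F(2) by blast
    then show "x \<in> \<Union> {I \<in> F. is_singleton I}" using op I by blast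
  qed
  moreover have "finite (\<Union> {I \<in> F. is_singleton I})"
    using F(1) by (auto simp: is_singleton_def)
  moreover have "?S = {a. P (e(v := a))}" unfolding Q interleave_upd using p by simp
  ultimately show ?thesis using finite_subset by metis
qed

section \<open>Borel measurability and null sets\<close>

text \<open>The second disjunct puts t into the closure of the finite set
  \<open>S - interior S\<close>, which is that set itself. In this form t is only compared with
  rationals, and each condition on \<open>S\<close> is one of countably many; both are what
  measurability in t and in \<open>S\<close> requires.\<close>

lemma real_set_rat_interval_iff:
  fixes S :: "real set"
  assumes "finite (S - interior S)"
  shows "t \<in> S \<longleftrightarrow>
    (\<exists>q\<in>\<rat>. \<exists>r\<in>\<rat>. q < t \<and> t < r \<and> {q<..<r} \<subseteq> S) \<or>
    (\<forall>q\<in>\<rat>. \<forall>r\<in>\<rat>. q < t \<and> t < r \<longrightarrow> {q<..<r} \<inter> (S - interior S) \<noteq> {})"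
proof
  assume "t \<in> S"
  show "(\<exists>q\<in>\<rat>. \<exists>r\<in>\<rat>. q < t \<and> t < r \<and> {q<..<r} \<subseteq> S) \<or>
    (\<forall>q\<in>\<rat>. \<forall>r\<in>\<rat>. q < t \<and> t < r \<longrightarrow> {q<..<r} \<inter> (S - interior S) \<noteq> {})"
  proof (cases "t \<in> interior S")
    case True
    then obtain e where e: "e > 0" "ball t e \<subseteq> S" by (auto simp: mem_interior)
    obtain q where q: "q \<in> \<rat>" "t - e < q" "q < t" using Rats_dense_in_real[of "t - e" t] e by auto
    obtain r where r: "r \<in> \<rat>" "t < r" "r < t + e" using Rats_dense_in_real[of t "t + e"] e by auto
    have "{q<..<r} \<subseteq> ball t e" using q r by (auto simp: dist_real_def)
    with e q r show ?thesis by blast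
  next
    case False
    with \<open>t \<in> S\<close> show ?thesis by auto
  qed
next
  assume R: "(\<exists>q\<in>\<rat>. \<exists>r\<in>\<rat>. q < t \<and> t < r \<and> {q<..<r} \<subseteq> S) \<or>
    (\<forall>q\<in>\<rat>. \<forall>r\<in>\<rat>. q < t \<and> t < r \<longrightarrow> {q<..<r} \<inter> (S - interior S) \<noteq> {})"
  show "t \<in> S"
  proof (rule ccontr)
    assume t: "t \<notin> S"
    obtain e where e: "e > 0" "\<forall>x\<in>S - interior S. x \<noteq> t \<longrightarrow> e \<le> dist t x"
      using finite_set_avoid[OF assms, of t] by auto
    obtain q where q: "q \<in> \<rat>" "t - e < q" "q < t" using Rats_dense_in_real[of "t - e" t] e by auto
    obtain r where r: "r \<in> \<rat>" "t < r" "r < t + e" using Rats_dense_in_real[of t "t + e"] e by auto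
    have "{q<..<r} \<inter> (S - interior S) = {}"
    proof (rule ccontr)
      assume "{q<..<r} \<inter> (S - interior S) \<noteq> {}"
      then obtain x where "x \<in> {q<..<r}" and x: "x \<in> S - interior S" by blast
      then have "q < x" "x < r" by simp_all
      have "e \<le> dist t x" using e t x by auto
      with \<open>q < x\<close> \<open>x < r\<close> q r show False by (auto simp: dist_real_def)
    qed
    with R q r t show False by fastforce
  qed
qed

text \<open>The right-hand side uses only the order and quantifiers over reals, so the interior of a
  definable fibre is again definable.\<close>

lemma mem_interior_real_iff:
  fixes S :: "real set"
  shows "t \<in> interior S \<longleftrightarrow> (\<exists>a b. a < t \<and> t < b \<and> (\<forall>s. a < s \<and> s < b \<longrightarrow> s \<in> S))"
proof
  assume "t \<in> interior S"
  then obtain e where e: "e > 0" "ball t e \<subseteq> S" by (auto simp: mem_interior)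
  then show "\<exists>a b. a < t \<and> t < b \<and> (\<forall>s. a < s \<and> s < b \<longrightarrow> s \<in> S)"
    by (intro exI[of _ "t - e"] exI[of _ "t + e"]) (auto simp: dist_real_def subset_iff)
next
  assume "\<exists>a b. a < t \<and> t < b \<and> (\<forall>s. a < s \<and> s < b \<longrightarrow> s \<in> S)"
  then obtain a b where "a < t" "t < b" "\<forall>s. a < s \<and> s < b \<longrightarrow> s \<in> S" by blast
  moreover from this have "{a<..<b} \<subseteq> S" by auto
  ultimately show "t \<in> interior S" using interior_maximal[of "{a<..<b}" S] by auto
qed

lemma param_pred_interval_subset:
  assumes "param_pred M P"
  shows "param_pred M (\<lambda>e. {q<..<r} \<subseteq> {a. P (e(w := a))})"
proof -
  have "param_pred M (\<lambda>e. \<forall>a. (q < (e(w := a)) w \<and> (e(w := a)) w < r) \<longrightarrow> P (e(w := a)))"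
    by (rule param_pred.all[of M "\<lambda>e. q < e w \<and> e w < r \<longrightarrow> P e" w])
      (intro param_pred.imp param_pred.conj param_pred_less_const param_pred_greater_const assms)
  then show ?thesis by (simp add: subset_iff)
qed

lemma param_pred_interval_meets_boundary:
  assumes "param_pred M P"
  shows "param_pred M (\<lambda>e. {q<..<r} \<inter> ({a. P (e(w := a))} - interior {a. P (e(w := a))}) \<noteq> {})"
proof -
  obtain N where N: "\<And>v e a. v \<ge> N \<Longrightarrow> P (e(v := a)) = P e"
    using param_pred_finite_support[OF assms] by blast
  \<comment> \<open>Two variables for the end points of an interval: at least \<open>N\<close>, so
    that \<open>P\<close> ignores them, and distinct from \<open>w\<close> and from each
    other.\<close>
  define u u' where "u = max N (Suc w)" and "u' = Suc u"
  have ne: "u \<ge> N" "u' \<ge> N" "u \<noteq> w" "u' \<noteq> w" "u' \<noteq> u" by (auto simp: u_def u'_def)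
  define J where "J = (\<lambda>e. \<forall>s. e u < s \<and> s < e u' \<longrightarrow> P (e(w := s)))"
  have "param_pred M (\<lambda>e. \<forall>s. (e(w := s)) u < (e(w := s)) w \<and> (e(w := s)) w < (e(w := s)) u' \<longrightarrow> P (e(w := s)))"
    by (rule param_pred.all[of M "\<lambda>e. e u < e w \<and> e w < e u' \<longrightarrow> P e" w])
      (intro param_pred.imp param_pred.conj param_pred.less assms)
  then have J: "param_pred M J" unfolding J_def using ne by simp
  \<comment> \<open>\<open>K\<close> says that the value of \<open>w\<close> is an interior point of
    the fibre; \<open>J\<close> expresses the containment of the interval between the variables
    \<open>u\<close> and \<open>u'\<close>.\<close>
  define K where "K = (\<lambda>e. \<exists>a b. a < e w \<and> e w < b \<and> (\<forall>s. a < s \<and> s < b \<longrightarrow> P (e(w := s))))"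
  have "param_pred M (\<lambda>e. \<exists>a b. ((\<lambda>e. e u < e w \<and> e w < e u' \<and> J e) (e(u := a, u' := b))))"
    by (intro param_pred.ex[of M "\<lambda>e. \<exists>b. (e(u' := b)) u < (e(u' := b)) w \<and> (e(u' := b)) w < (e(u' := b)) u' \<and> J (e(u' := b))" u]
        param_pred.ex[of M "\<lambda>e. e u < e w \<and> e w < e u' \<and> J e" u'] param_pred.conj param_pred.less J)
  also have "(\<lambda>e. \<exists>a b. ((\<lambda>e. e u < e w \<and> e w < e u' \<and> J e) (e(u := a, u' := b)))) = K"
  proof -
    have "P (e(u := a, u' := b, w := s)) = P (e(w := s))" for e a b s
      using N[of u] N[of u'] ne by (metis fun_upd_twist)
    then show ?thesis unfolding K_def J_def using ne by simp
  qed
  finally have K: "param_pred M K" .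
  have "param_pred M (\<lambda>e. \<exists>t. q < (e(w := t)) w \<and> (e(w := t)) w < r \<and> P (e(w := t)) \<and> \<not> K (e(w := t)))"
    by (rule param_pred.ex[of M "\<lambda>e. q < e w \<and> e w < r \<and> P e \<and> \<not> K e" w])
      (intro param_pred.conj param_pred.neg param_pred_less_const param_pred_greater_const assms K)
  also have "(\<lambda>e. \<exists>t. q < (e(w := t)) w \<and> (e(w := t)) w < r \<and> P (e(w := t)) \<and> \<not> K (e(w := t))) =
    (\<lambda>e. {q<..<r} \<inter> ({a. P (e(w := a))} - interior {a. P (e(w := a))}) \<noteq> {})"
  proof -
    have "K (e(w := t)) \<longleftrightarrow> t \<in> interior {a. P (e(w := a))}" for e t
      unfolding K_def mem_interior_real_iff by simp
    then show ?thesis by (auto simp: fun_eq_iff)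
  qed
  finally show ?thesis .
qed

text \<open>The coordinates \<open>F x v\<close> are arbitrary measurable functions, so that the
  same result applies to Euclidean space, to product measures and to single fibres.\<close>

proposition param_pred_measurable:
  assumes "o_minimal M" "finite V" "param_pred M P"
    and "\<And>v. v \<in> V \<Longrightarrow> (\<lambda>x. F x v) \<in> borel_measurable N"
  shows "Measurable.pred N (\<lambda>x. P (\<lambda>v. if v \<in> V then F x v else b v))"
  using assms(2-)
proof (induction V arbitrary: P)
  case empty
  then show ?case by simp
next
  case (insert w V)
  define env where "env = (\<lambda>x v. if v \<in> V then F x v else b v)"
  have env: "(\<lambda>v. if v \<in> insert w V then F x v else b v) = (env x)(w := F x w)" for x
    using insert.hyps by (auto simp: env_def)
  define S where "S = (\<lambda>x. {a. P ((env x)(w := a))})"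
  \<comment> \<open>The induction hypothesis is needed for the interval conditions derived from
    \<open>P\<close>, not for \<open>P\<close> itself; these quantify over \<open>w\<close> and
    leave only the variables in \<open>V\<close>.\<close>
  have IH: "Measurable.pred N (\<lambda>x. Q (env x))" if "param_pred M Q" for Q
    unfolding env_def by (rule insert.IH) (use that insert.prems in auto)
  have [measurable]: "Measurable.pred N (\<lambda>x. {q<..<r} \<subseteq> S x)" for q r
    unfolding S_def by (rule IH) (rule param_pred_interval_subset[OF insert.prems(1)])
  have [measurable]: "Measurable.pred N (\<lambda>x. {q<..<r} \<inter> (S x - interior (S x)) \<noteq> {})" for q r
    unfolding S_def by (rule IH) (rule param_pred_interval_meets_boundary[OF insert.prems(1)])
  have [measurable]: "(\<lambda>x. F x w) \<in> borel_measurable N" using insert.prems by auto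
  have "finite (S x - interior (S x))" for x
    unfolding S_def by (rule param_pred_fibre_finite[OF assms(1) insert.prems(1)])
  then have "P ((env x)(w := F x w)) \<longleftrightarrow>
    (\<exists>q\<in>\<rat>. \<exists>r\<in>\<rat>. q < F x w \<and> F x w < r \<and> {q<..<r} \<subseteq> S x) \<or>
    (\<forall>q\<in>\<rat>. \<forall>r\<in>\<rat>. q < F x w \<and> F x w < r \<longrightarrow> {q<..<r} \<inter> (S x - interior (S x)) \<noteq> {})" for x
    using real_set_rat_interval_iff[of "S x" "F x w"] by (simp add: S_def)
  moreover have "Measurable.pred N (\<lambda>x.
    (\<exists>q\<in>\<rat>. \<exists>r\<in>\<rat>. q < F x w \<and> F x w < r \<and> {q<..<r} \<subseteq> S x) \<or>
    (\<forall>q\<in>\<rat>. \<forall>r\<in>\<rat>. q < F x w \<and> F x w < r \<longrightarrow> {q<..<r} \<inter> (S x - interior (S x)) \<noteq> {}))"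
    \<comment> \<open>Quantifiers over \<open>\<rat>\<close> become quantifiers over the countable
      type \<open>rat\<close>, under which measurable predicates are closed.\<close>
    unfolding Rats_def bex_simps ball_simps by measurable
  ultimately show ?case unfolding env by simp
qed

text \<open>The map \<open>s\<close> is there because Lebesgue measure on \<open>real ^ 'm\<close>
  is a product indexed by basis vectors, whereas variables are natural numbers.\<close>

proposition param_pred_null_or_box:
  assumes "o_minimal M" "finite V" "inj_on s V" "param_pred M P"
    and "emeasure (Pi\<^sub>M (s ` V) (\<lambda>_. lborel))
      {x \<in> space (Pi\<^sub>M (s ` V) (\<lambda>_. lborel)). P (\<lambda>v. if v \<in> V then x (s v) else b v)} \<noteq> 0"
  shows "\<exists>l r. (\<forall>v\<in>V. l v < r v) \<and>
    (\<forall>y. (\<forall>v\<in>V. l v < y v \<and> y v < r v) \<longrightarrow> P (\<lambda>v. if v \<in> V then y v else b v))"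
  using assms(2-)
proof (induction V arbitrary: P)
  case empty
  \<comment> \<open>Over the empty index set the given set is everything or nothing, so a nonzero
    measure means that \<open>P b\<close> holds.\<close>
  then show ?case by (auto simp: space_PiM intro: ccontr)
next
  case (insert w V)
  interpret product_sigma_finite "\<lambda>_ :: 'c. lborel :: real measure" by standard
  define env where "env = (\<lambda>x v. if v \<in> V then x (s v) else b v)"
  define S where "S = (\<lambda>x. {a. P ((env x)(w := a))})"
  define A where "A = {x \<in> space (Pi\<^sub>M (s ` insert w V) (\<lambda>_. lborel)).
      P (\<lambda>v. if v \<in> insert w V then x (s v) else b v)}"
  have [measurable]: "Measurable.pred (Pi\<^sub>M (s ` insert w V) (\<lambda>_. lborel)) 
      (\<lambda>x. P (\<lambda>v. if v \<in> insert w V then x (s v) else b v))"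
    by (rule param_pred_measurable[OF assms(1) _ insert.prems(2)]) (use insert.hyps in auto)
  have A: "A \<in> sets (Pi\<^sub>M (s ` insert w V) (\<lambda>_. lborel))"
    unfolding A_def by measurable
  have sw: "s w \<notin> s ` V" using insert.hyps insert.prems(1) by (auto simp: inj_on_def)
  have ins: "s ` insert w V = insert (s w) (s ` V)" by simp
  have "emeasure (Pi\<^sub>M (s ` insert w V) (\<lambda>_. lborel)) A =
     (\<integral>\<^sup>+x. indicator A x \<partial>(Pi\<^sub>M (insert (s w) (s ` V)) (\<lambda>_. lborel)))"
    using A by simp
  also have "\<dots> = (\<integral>\<^sup>+x. (\<integral>\<^sup>+a. indicator A (x(s w := a)) \<partial>lborel) \<partial>(Pi\<^sub>M (s ` V) (\<lambda>_. lborel)))"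
    by (rule product_nn_integral_insert) (use insert.hyps sw A in auto)
  also have "\<dots> = (\<integral>\<^sup>+x. emeasure lborel (S x) \<partial>(Pi\<^sub>M (s ` V) (\<lambda>_. lborel)))"
  proof (rule nn_integral_cong)
    fix x assume x: "x \<in> space (Pi\<^sub>M (s ` V) (\<lambda>_. lborel :: real measure))"
    have [measurable]: "S x \<in> sets borel"
    proof -
      have "Measurable.pred borel (\<lambda>a. P (\<lambda>v. if v \<in> {w} then (\<lambda>a v. a) a v else env x v))"
        by (rule param_pred_measurable[OF assms(1) _ insert.prems(2)]) auto
      moreover have "(\<lambda>v. if v \<in> {w} then (\<lambda>a v. a) a v else env x v) = (env x)(w := a)" for a
        by auto
      ultimately show ?thesis unfolding S_def by (simp add: pred_def)
    qed
    have "x(s w := a) \<in> A \<longleftrightarrow> a \<in> S x" for a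
    proof -
      have "(\<lambda>v. if v \<in> insert w V then (x(s w := a)) (s v) else b v) = (env x)(w := a)"
      proof -
        have "s v \<noteq> s w" if "v \<in> V" for v using sw that by (metis imageI)
        then show ?thesis using insert.hyps by (auto simp: env_def fun_eq_iff)
      qed
      moreover have "x(s w := a) \<in> space (Pi\<^sub>M (s ` insert w V) (\<lambda>_. lborel))"
        using x by (auto simp: space_PiM PiE_def extensional_def)
      ultimately show ?thesis unfolding A_def S_def by simp
    qed
    then have "(\<integral>\<^sup>+a. indicator A (x(s w := a)) \<partial>lborel) = (\<integral>\<^sup>+a. indicator (S x) a \<partial>lborel)"
      by (intro nn_integral_cong) (simp add: indicator_def)
    then show "(\<integral>\<^sup>+a. indicator A (x(s w := a)) \<partial>lborel) = emeasure lborel (S x)" by simp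
  qed
  finally have eq: "emeasure (Pi\<^sub>M (s ` insert w V) (\<lambda>_. lborel)) A =
     (\<integral>\<^sup>+x. emeasure lborel (S x) \<partial>(Pi\<^sub>M (s ` V) (\<lambda>_. lborel)))" .
  define Q where "Q = (\<lambda>q r e. {q<..<r} \<subseteq> {a. P (e(w := a))})"
  have Q: "param_pred M (Q q r)" for q r
    unfolding Q_def by (rule param_pred_interval_subset[OF insert.prems(2)])
  have SQ: "{q<..<r} \<subseteq> S x \<longleftrightarrow> Q q r (env x)" for q r x by (simp add: S_def Q_def)
  have [measurable]: "Measurable.pred (Pi\<^sub>M (s ` V) (\<lambda>_. lborel)) (\<lambda>x. Q q r (env x))" for q r
    unfolding env_def by (rule param_pred_measurable[OF assms(1) _ Q]) (use insert.hyps in auto)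
  have "\<exists>q\<in>\<rat>. \<exists>r\<in>\<rat>. q < r \<and> emeasure (Pi\<^sub>M (s ` V) (\<lambda>_. lborel))
      {x \<in> space (Pi\<^sub>M (s ` V) (\<lambda>_. lborel)). Q q r (env x)} \<noteq> 0"
  proof (rule ccontr)
    assume neg: "\<not> ?thesis"
    \<comment> \<open>If all these countably many sets were null, almost every fibre would contain
      no rational interval. Such a fibre has empty interior, hence is finite and null, and Fubini
      would give total measure 0.\<close>
    have "AE x in Pi\<^sub>M (s ` V) (\<lambda>_. lborel). \<forall>q\<in>\<rat>. \<forall>r\<in>\<rat>. q < r \<longrightarrow> \<not> Q q r (env x)"
      unfolding AE_ball_countable[OF countable_rat]
    proof (intro ballI)
      fix q r :: real assume "q \<in> \<rat>" "r \<in> \<rat>"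
      show "AE x in Pi\<^sub>M (s ` V) (\<lambda>_. lborel). q < r \<longrightarrow> \<not> Q q r (env x)"
      proof (cases "q < r")
        case True
        then have "emeasure (Pi\<^sub>M (s ` V) (\<lambda>_. lborel))
          {x \<in> space (Pi\<^sub>M (s ` V) (\<lambda>_. lborel)). Q q r (env x)} = 0"
          using neg \<open>q \<in> \<rat>\<close> \<open>r \<in> \<rat>\<close> by blast
        then show ?thesis by (subst AE_iff_measurable[OF _ refl]) (auto simp: True)
      qed auto
    qed
    then have "AE x in Pi\<^sub>M (s ` V) (\<lambda>_. lborel). emeasure lborel (S x) = 0"
    proof (rule AE_mp, intro AE_I2 impI)
      fix x assume H: "\<forall>q\<in>\<rat>. \<forall>r\<in>\<rat>. q < r \<longrightarrow> \<not> Q q r (env x)"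
      have "interior (S x) = {}"
      proof (rule ccontr)
        assume "interior (S x) \<noteq> {}"
        then obtain t where t: "t \<in> interior (S x)" by auto
        then obtain a c where ac: "a < t" "t < c" "\<And>s. a < s \<Longrightarrow> s < c \<Longrightarrow> s \<in> S x"
          unfolding mem_interior_real_iff by auto
        obtain q where q: "q \<in> \<rat>" "a < q" "q < t" using Rats_dense_in_real[OF ac(1)] by auto
        obtain r where r: "r \<in> \<rat>" "t < r" "r < c" using Rats_dense_in_real[OF ac(2)] by auto
        have "{q<..<r} \<subseteq> S x" using ac(3) q r by auto
        then show False using H q r unfolding SQ by force
      qed
      then have "finite (S x)"
        using param_pred_fibre_finite[OF assms(1) insert.prems(2), of "env x" w]
        by (simp only: S_def Diff_empty)
      then show "emeasure lborel (S x) = 0" using finite_imp_null_set_lborel by auto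
    qed
    then have "(\<integral>\<^sup>+x. emeasure lborel (S x) \<partial>(Pi\<^sub>M (s ` V) (\<lambda>_. lborel))) = 0"
      using nn_integral_cong_AE[of "\<lambda>x. emeasure lborel (S x)" "\<lambda>_. 0"] by simp
    then show False using eq insert.prems(3) unfolding A_def by simp
  qed
  then obtain q r where qr: "q < r" and nz: "emeasure (Pi\<^sub>M (s ` V) (\<lambda>_. lborel))
      {x \<in> space (Pi\<^sub>M (s ` V) (\<lambda>_. lborel)). Q q r (env x)} \<noteq> 0" by blast
  obtain l h where lh: "\<forall>v\<in>V. l v < h v"
    "\<And>y. \<forall>v\<in>V. l v < y v \<and> y v < h v \<Longrightarrow> Q q r (\<lambda>v. if v \<in> V then y v else b v)"
    using insert.IH[OF _ Q nz[unfolded env_def]] insert.prems(1) by auto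
  \<comment> \<open>The box is the product of the box found in the base with the rational interval
    that lies in every fibre over it.\<close>
  show ?case
  proof (intro exI conjI allI impI)
    show "\<forall>v\<in>insert w V. (l(w := q)) v < (h(w := r)) v" using qr lh(1) by auto
    fix y assume y: "\<forall>v\<in>insert w V. (l(w := q)) v < y v \<and> y v < (h(w := r)) v"
    then have "Q q r (\<lambda>v. if v \<in> V then y v else b v)"
      using insert.hyps by (intro lh(2)) (metis fun_upd_other insertCI)
    moreover have "y w \<in> {q<..<r}" using y by auto
    ultimately have "P ((\<lambda>v. if v \<in> V then y v else b v)(w := y w))" unfolding Q_def by auto
    moreover have "(\<lambda>v. if v \<in> V then y v else b v)(w := y w) =
        (\<lambda>v. if v \<in> insert w V then y v else b v)" by auto
    ultimately show "P (\<lambda>v. if v \<in> insert w V then y v else b v)" by simp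
  qed
qed

section \<open>Charts\<close>

lemma smooth_on_has_derivative:
  "smooth_on U f \<Longrightarrow> u \<in> U \<Longrightarrow> (f has_derivative frechet_derivative f (at u)) (at u)"
  unfolding smooth_on_def using frechet_derivative_works by (metis Ck_on.simps(2))

lemma smooth_on_continuous_derivative:
  "smooth_on U f \<Longrightarrow> continuous_on U (\<lambda>u. frechet_derivative f (at u) v)"
  unfolding smooth_on_def by (metis Ck_on.simps)

lemma smooth_on_continuous: "smooth_on U f \<Longrightarrow> continuous_on U f"
  unfolding smooth_on_def by (metis Ck_on.simps(1))

text \<open>Bounds the operator norm by finitely many values. For a derivative varying with the
  point these values are continuous by \<open>smooth_on_continuous_derivative\<close>, so the bound
  is continuous as well.\<close>

lemma norm_linear_le_Basis_sum:
  fixes f :: "'a::euclidean_space \<Rightarrow> 'b::real_normed_vector"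
  assumes "linear f"
  shows "norm (f x) \<le> (\<Sum>b\<in>Basis. norm (f b)) * norm x"
proof -
  have "f x = f (\<Sum>b\<in>Basis. (x \<bullet> b) *\<^sub>R b)" by (simp add: euclidean_representation)
  also have "\<dots> = (\<Sum>b\<in>Basis. (x \<bullet> b) *\<^sub>R f b)"
    using assms by (simp add: linear_sum linear_cmul)
  also have "norm \<dots> \<le> (\<Sum>b\<in>Basis. norm (f b) * norm x)"
  proof (rule sum_norm_le)
    fix b :: 'a assume "b \<in> Basis"
    then have "\<bar>x \<bullet> b\<bar> * norm (f b) \<le> norm x * norm (f b)"
      by (intro mult_right_mono Basis_le_norm) auto
    then show "norm ((x \<bullet> b) *\<^sub>R f b) \<le> norm (f b) * norm x" by (simp add: mult.commute)
  qed
  finally show ?thesis by (simp add: sum_distrib_right)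
qed

context
  fixes X :: "(real ^ 'n::finite) set" and U :: "(real ^ 'm::finite) set" and \<phi>
  assumes lp: "local_parametrization X U \<phi>"
begin

lemma chart_open: "open U"
  using lp unfolding local_parametrization_def by blast

lemma chart_smooth: "smooth_on U \<phi>"
  using lp unfolding local_parametrization_def by blast

lemma chart_has_derivative:
  "u \<in> U \<Longrightarrow> (\<phi> has_derivative frechet_derivative \<phi> (at u)) (at u)"
  by (rule smooth_on_has_derivative[OF chart_smooth])

lemma chart_linear: "u \<in> U \<Longrightarrow> linear (frechet_derivative \<phi> (at u))"
  using chart_has_derivative has_derivative_bounded_linear bounded_linear.linear by blast

lemma chart_inj: "u \<in> U \<Longrightarrow> inj (frechet_derivative \<phi> (at u))"
  using lp unfolding local_parametrization_def by blast

lemma chart_inj_on: "inj_on \<phi> U"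
  using lp unfolding local_parametrization_def homeomorphism_def by (metis inj_onI)

lemma chart_subset: "\<phi> ` U \<subseteq> X"
  using lp unfolding local_parametrization_def openin_subset by (metis openin_imp_subset)

lemma chart_image_openin:
  assumes "open O'" "O' \<subseteq> U"
  shows "openin (top_of_set X) (\<phi> ` O')"
proof -
  obtain \<psi> where "homeomorphism U (\<phi> ` U) \<phi> \<psi>" "openin (top_of_set X) (\<phi> ` U)"
    using lp unfolding local_parametrization_def by blast
  moreover have "openin (top_of_set U) O'" using assms by (simp add: open_subset)
  ultimately show ?thesis using homeomorphism_imp_open_map openin_trans by blast
qed

text \<open>Choose \<open>L\<close> as a left inverse of the derivative at \<open>u\<^sub>0\<close>.
  Near \<open>u\<^sub>0\<close> the map L \<circ> \<phi> differs from the identity by a map with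
  Lipschitz constant 1/2, so it shrinks distances by at most the factor 1 - 1/2.\<close>

lemma chart_bilipschitz:
  assumes "u\<^sub>0 \<in> U"
  shows "\<exists>r>0. \<exists>L :: real ^ 'n \<Rightarrow> real ^ 'm. linear L \<and> cball u\<^sub>0 r \<subseteq> U \<and>
    (\<forall>u\<in>cball u\<^sub>0 r. \<forall>u'\<in>cball u\<^sub>0 r. norm (u - u') \<le> 2 * norm (L (\<phi> u) - L (\<phi> u')))"
proof -
  define D where "D = (\<lambda>u. frechet_derivative \<phi> (at u))"
  obtain L where L: "linear L" "L \<circ> D u\<^sub>0 = id"
    using linear_injective_left_inverse[OF chart_linear chart_inj] assms unfolding D_def by blast
  have bL: "bounded_linear L" using L(1) by (simp add: linear_conv_bounded_linear)
  \<comment> \<open>A continuous majorant of the operator norm of \<open>L \<circ> D u - id\<close>,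
    vanishing at \<open>u\<^sub>0\<close>.\<close>
  define m where "m = (\<lambda>u. \<Sum>b\<in>Basis. norm (L (D u b) - b))"
  have "continuous_on U m"
    unfolding m_def D_def
    by (intro continuous_intros bounded_linear.continuous_on[OF bL]
        smooth_on_continuous_derivative[OF chart_smooth])
  then have "open (U \<inter> m -` {..<1/2})"
    by (rule openin_open_trans[OF continuous_openin_preimage_gen[OF _ open_lessThan] chart_open])
  moreover have "U \<inter> m -` {..<1/2} = {u \<in> U. m u < 1/2}" by auto
  ultimately have "open {u \<in> U. m u < 1/2}" by simp
  moreover have "u\<^sub>0 \<in> {u \<in> U. m u < 1/2}"
    using L(2) assms by (simp add: m_def fun_eq_iff)
  ultimately obtain r where r: "r > 0" "cball u\<^sub>0 r \<subseteq> {u \<in> U. m u < 1/2}"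
    by (meson open_contains_cball)
  have "norm (u - u') \<le> 2 * norm (L (\<phi> u) - L (\<phi> u'))" if u: "u \<in> cball u\<^sub>0 r" "u' \<in> cball u\<^sub>0 r" for u u'
  proof -
    define h where "h = (\<lambda>u. L (\<phi> u) - u)"
    have "norm (h u - h u') \<le> 1/2 * norm (u - u')"
    proof (rule differentiable_bound[OF convex_cball _ _ u])
      fix x assume "x \<in> cball u\<^sub>0 r"
      then have x: "x \<in> U" "m x < 1/2" using r by auto
      show "(h has_derivative (\<lambda>\<xi>. L (D x \<xi>) - \<xi>)) (at x within cball u\<^sub>0 r)"
        unfolding h_def D_def
        by (rule has_derivative_at_withinI, rule has_derivative_diff[OF
            bounded_linear.has_derivative[OF bL chart_has_derivative[OF x(1)]] has_derivative_ident])
      have "linear (\<lambda>\<xi>. L (D x \<xi>) - \<xi>)"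
        using linear_compose_sub[OF linear_compose[OF chart_linear[OF x(1)] L(1)] linear_id]
        by (simp add: D_def o_def)
      then have "norm (L (D x \<xi>) - \<xi>) \<le> m x * norm \<xi>" for \<xi>
        unfolding m_def by (rule norm_linear_le_Basis_sum)
      then have "norm (L (D x \<xi>) - \<xi>) \<le> 1/2 * norm \<xi>" for \<xi>
        using x(2) by (meson less_imp_le mult_right_mono norm_ge_zero order_trans)
      then show "onorm (\<lambda>\<xi>. L (D x \<xi>) - \<xi>) \<le> 1/2" by (rule onorm_le)
    qed
    moreover have "norm (u - u') \<le> norm (h u - h u') + norm (L (\<phi> u) - L (\<phi> u'))"
    proof -
      have "u - u' = (L (\<phi> u) - L (\<phi> u')) - (h u - h u')" by (simp add: h_def)
      then show ?thesis using norm_triangle_ineq4 by (metis add.commute)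
    qed
    ultimately show ?thesis by simp
  qed
  moreover have "cball u\<^sub>0 r \<subseteq> U" using r(2) by blast
  ultimately have "r > 0 \<and> linear L \<and> cball u\<^sub>0 r \<subseteq> U \<and>
    (\<forall>u\<in>cball u\<^sub>0 r. \<forall>u'\<in>cball u\<^sub>0 r. norm (u - u') \<le> 2 * norm (L (\<phi> u) - L (\<phi> u')))"
    using r(1) L(1) by simp
  then show ?thesis by blast
qed

section \<open>Comparing the metric with Euclidean norms on compact sets\<close>

context
  fixes g
  assumes rm: "riemannian_metric TYPE('m) X g"
begin

lemma pullback_bilinear: "u \<in> U \<Longrightarrow> bilinear (pullback_metric g \<phi> u)"
  using rm lp unfolding riemannian_metric_def by blast

lemma pullback_pos: "u \<in> U \<Longrightarrow> \<xi> \<noteq> 0 \<Longrightarrow> pullback_metric g \<phi> u \<xi> \<xi> > 0"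
  using rm lp unfolding riemannian_metric_def by blast

lemma pullback_continuous: "continuous_on U (\<lambda>u. pullback_metric g \<phi> u \<xi> \<eta>)"
  using rm lp smooth_on_continuous unfolding riemannian_metric_def by blast

lemma pullback_scale:
  "u \<in> U \<Longrightarrow> pullback_metric g \<phi> u (c *\<^sub>R \<xi>) (c *\<^sub>R \<xi>) = c\<^sup>2 * pullback_metric g \<phi> u \<xi> \<xi>"
  using pullback_bilinear by (simp add: bilinear_lmul bilinear_rmul power2_eq_square)

text \<open>By homogeneity only unit vectors matter, and \<open>K\<close> times the unit sphere is
  compact; the metric is positive there, so both quotients are continuous and bounded. The first
  bound makes chart segments short, the second makes long Euclidean displacements expensive.\<close>

lemma pullback_bounds:
  assumes "compact K" "K \<subseteq> U"
  shows "\<exists>C>0. \<forall>u\<in>K. \<forall>\<xi>. sqrt (pullback_metric g \<phi> u \<xi> \<xi>) \<le> C * norm \<xi> \<and>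
    norm (frechet_derivative \<phi> (at u) \<xi>) \<le> C * sqrt (pullback_metric g \<phi> u \<xi> \<xi>)"
proof -
  define G where "G = pullback_metric g \<phi>"
  define D where "D = (\<lambda>u. frechet_derivative \<phi> (at u))"
  let ?S = "K \<times> sphere (0 :: real ^ 'm) 1"
  have S: "compact ?S" using assms(1) by (intro compact_Times compact_sphere)
  have c1: "continuous_on ?S (\<lambda>(u, \<xi>). G u \<xi> \<xi>)"
  proof -
    \<comment> \<open>Smoothness gives continuity in the base point for fixed vectors only.
      Expanding in the basis turns this into joint continuity.\<close>
    have "continuous_on ?S (\<lambda>z. \<Sum>(i, j)\<in>Basis \<times> Basis. (snd z \<bullet> i) * ((snd z \<bullet> j) * G (fst z) i j))"
      unfolding case_prod_beta G_def
      by (intro continuous_intros continuous_on_compose2[OF pullback_continuous continuous_on_fst[OF continuous_on_id]])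
        (use assms(2) in auto)
    moreover have "(\<Sum>(i, j)\<in>Basis \<times> Basis. (snd z \<bullet> i) * ((snd z \<bullet> j) * G (fst z) i j)) = G (fst z) (snd z) (snd z)"
      if "z \<in> ?S" for z
    proof -
      have b: "bilinear (G (fst z))" using that assms(2) pullback_bilinear unfolding G_def by auto
      have "G (fst z) (snd z) (snd z) =
        G (fst z) (\<Sum>b\<in>Basis. (snd z \<bullet> b) *\<^sub>R b) (\<Sum>b\<in>Basis. (snd z \<bullet> b) *\<^sub>R b)"
        by (simp add: euclidean_representation)
      also have "\<dots> = (\<Sum>(i, j)\<in>Basis \<times> Basis. (snd z \<bullet> i) * ((snd z \<bullet> j) * G (fst z) i j))"
        using b by (simp add: bilinear_sum bilinear_lmul bilinear_rmul)
      finally show ?thesis by simp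
    qed
    ultimately show ?thesis unfolding case_prod_beta by (rule continuous_on_eq)
  qed
  have c2: "continuous_on ?S (\<lambda>(u, \<xi>). D u \<xi>)"
  proof -
    have "continuous_on ?S (\<lambda>z. \<Sum>i\<in>Basis. (snd z \<bullet> i) *\<^sub>R D (fst z) i)"
      unfolding D_def
      by (intro continuous_intros continuous_on_compose2[OF smooth_on_continuous_derivative[OF chart_smooth] continuous_on_fst[OF continuous_on_id]])
        (use assms(2) in auto)
    moreover have "(\<Sum>i\<in>Basis. (snd z \<bullet> i) *\<^sub>R D (fst z) i) = D (fst z) (snd z)" if "z \<in> ?S" for z
    proof -
      have l: "linear (D (fst z))" using that assms(2) chart_linear unfolding D_def by auto
      have "D (fst z) (snd z) = D (fst z) (\<Sum>b\<in>Basis. (snd z \<bullet> b) *\<^sub>R b)"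
        by (simp add: euclidean_representation)
      also have "\<dots> = (\<Sum>i\<in>Basis. (snd z \<bullet> i) *\<^sub>R D (fst z) i)"
        using l by (simp add: linear_sum linear_cmul)
      finally show ?thesis by simp
    qed
    ultimately show ?thesis unfolding case_prod_beta by (rule continuous_on_eq)
  qed
  have pos: "G u \<xi> \<xi> > 0" if "(u, \<xi>) \<in> ?S" for u \<xi>
  proof -
    have "u \<in> U" "\<xi> \<noteq> 0" using that assms(2) by auto
    then show ?thesis unfolding G_def by (rule pullback_pos)
  qed
  have bdd: "\<exists>B. \<forall>z\<in>?S. f z \<le> B" if "continuous_on ?S f" for f :: "_ \<Rightarrow> real"
  proof -
    have "bounded (f ` ?S)" using that S by (intro compact_imp_bounded compact_continuous_image)
    then obtain B where "\<forall>z\<in>?S. norm (f z) \<le> B" unfolding bounded_iff by blast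
    moreover have "f z \<le> norm (f z)" for z by simp
    ultimately show ?thesis by (meson order_trans)
  qed
  have ne: "\<forall>z\<in>?S. sqrt (G (fst z) (snd z) (snd z)) \<noteq> 0"
  proof
    fix z assume "z \<in> ?S"
    then have "G (fst z) (snd z) (snd z) > 0" using pos[of "fst z" "snd z"] by simp
    then show "sqrt (G (fst z) (snd z) (snd z)) \<noteq> 0" by simp
  qed
  obtain C1 where "\<forall>z\<in>?S. sqrt (G (fst z) (snd z) (snd z)) \<le> C1"
    using bdd[OF continuous_on_real_sqrt[OF c1[unfolded case_prod_beta]]] by blast
  then have C1: "sqrt (G u \<xi> \<xi>) \<le> C1" if "(u, \<xi>) \<in> ?S" for u \<xi> using that by (metis fst_conv snd_conv)
  obtain C2 where "\<forall>z\<in>?S. norm (D (fst z) (snd z)) / sqrt (G (fst z) (snd z) (snd z)) \<le> C2"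
    using bdd[OF continuous_on_divide[OF continuous_on_norm[OF c2[unfolded case_prod_beta]]
        continuous_on_real_sqrt[OF c1[unfolded case_prod_beta]] ne]] by blast
  then have C2: "norm (D u \<xi>) / sqrt (G u \<xi> \<xi>) \<le> C2" if "(u, \<xi>) \<in> ?S" for u \<xi>
    using that by (metis fst_conv snd_conv)
  \<comment> \<open>The 1 guarantees that the constant is positive.\<close>
  define C where "C = max 1 (max C1 C2)"
  have "sqrt (G u \<xi> \<xi>) \<le> C * norm \<xi> \<and> norm (D u \<xi>) \<le> C * sqrt (G u \<xi> \<xi>)" if u: "u \<in> K" for u \<xi>
  proof (cases "\<xi> = 0")
    case True
    then show ?thesis
      using bilinear_lzero[OF pullback_bilinear, of u] linear_0[OF chart_linear, of u] u assms(2)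
      by (auto simp: G_def D_def)
  next
    case False
    define \<eta> where "\<eta> = \<xi> /\<^sub>R norm \<xi>"
    have \<xi>: "\<xi> = norm \<xi> *\<^sub>R \<eta>" using False by (simp add: \<eta>_def)
    have \<eta>: "(u, \<eta>) \<in> ?S" using False u by (simp add: \<eta>_def)
    have "G u \<xi> \<xi> = (norm \<xi>)\<^sup>2 * G u \<eta> \<eta>"
      using pullback_scale[of u "norm \<xi>" \<eta>] u assms(2) \<xi> unfolding G_def by auto
    then have s: "sqrt (G u \<xi> \<xi>) = norm \<xi> * sqrt (G u \<eta> \<eta>)" by (simp add: real_sqrt_mult)
    have d: "norm (D u \<xi>) = norm \<xi> * norm (D u \<eta>)"
      using linear_cmul[OF chart_linear, of u "norm \<xi>" \<eta>] u assms(2) \<xi> unfolding D_def by auto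
    have "sqrt (G u \<eta> \<eta>) \<le> C" using C1[OF \<eta>] by (simp add: C_def)
    moreover have "norm (D u \<eta>) \<le> C * sqrt (G u \<eta> \<eta>)"
    proof -
      have "norm (D u \<eta>) / sqrt (G u \<eta> \<eta>) \<le> C" using C2[OF \<eta>] by (simp add: C_def)
      then show ?thesis using pos[OF \<eta>] by (simp add: divide_le_eq)
    qed
    ultimately have "norm \<xi> * sqrt (G u \<eta> \<eta>) \<le> norm \<xi> * C \<and>
      norm \<xi> * norm (D u \<eta>) \<le> norm \<xi> * (C * sqrt (G u \<eta> \<eta>))"
      by (simp only: mult_left_mono[OF _ norm_ge_zero] simp_thms)
    then show ?thesis unfolding s d by (simp add: mult_ac)
  qed
  moreover have "C > 0" by (simp add: C_def)
  ultimately show ?thesis unfolding G_def D_def by blast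
qed

end
end

section \<open>The geodesic topology\<close>

text \<open>Composing \<open>\<phi>\<close> with the projection \<open>I - D L\<close> along its tangent space gives a map with
  vanishing derivative at \<open>u\<close>, and the chart coordinates of the curve are Lipschitz in its position.\<close>

lemma velocity_in_tangent_space:
  fixes \<phi> :: "'a::euclidean_space \<Rightarrow> 'b::euclidean_space"
  assumes \<phi>: "(\<phi> has_derivative D) (at u)" and "inj D"
    and \<gamma>: "(\<gamma> has_vector_derivative v) (at t)" and "\<gamma> t = \<phi> u"
    and B: "\<forall>\<^sub>F s in at t. \<gamma> s \<in> \<phi> ` B"
    and K: "\<And>w. w \<in> B \<Longrightarrow> norm (w - u) \<le> K * norm (\<phi> w - \<phi> u)" "K > 0"
  shows "v \<in> range D"
proof -
  have D: "linear D" using \<phi> has_derivative_bounded_linear bounded_linear.linear by blast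
  obtain L where L: "linear L" "L \<circ> D = id"
    using linear_injective_left_inverse[OF D \<open>inj D\<close>] by blast
  define q where "q = (\<lambda>x. x - D (L x))"
  have "linear q"
    using linear_compose_sub[OF linear_id linear_compose[OF L(1) D]] by (simp add: q_def o_def)
  then have q: "bounded_linear q" by (simp add: linear_conv_bounded_linear)
  have qD: "q (D \<xi>) = 0" for \<xi> using L(2) by (simp add: q_def fun_eq_iff)
  have "((\<lambda>w. q (\<phi> w)) has_derivative (\<lambda>\<xi>. q (D \<xi>))) (at u)"
    by (rule bounded_linear.has_derivative[OF q \<phi>])
  then have q0: "\<exists>d>0. \<forall>w. norm (w - u) < d \<longrightarrow> norm (q (\<phi> w) - q (\<phi> u)) \<le> e * norm (w - u)"
    if "e > 0" for e
    using that unfolding qD has_derivative_at_alt by simp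
  have lim: "((\<lambda>s. (\<gamma> s - \<gamma> t) /\<^sub>R (s - t)) \<longlongrightarrow> v) (at t)"
  proof (rule LIM_zero_cancel, rule tendsto_norm_zero_cancel)
    have "((\<lambda>s. norm (\<gamma> s - \<gamma> t - (s - t) *\<^sub>R v) / norm (s - t)) \<longlongrightarrow> 0) (at t)"
      using \<gamma> unfolding has_vector_derivative_def has_derivative_iff_norm by simp
    moreover have "\<forall>\<^sub>F s in at t. norm (\<gamma> s - \<gamma> t - (s - t) *\<^sub>R v) / norm (s - t) =
        norm ((\<gamma> s - \<gamma> t) /\<^sub>R (s - t) - v)"
      unfolding eventually_at_filter
    proof (intro always_eventually allI impI)
      fix s assume "s \<noteq> t"
      then have "(\<gamma> s - \<gamma> t) /\<^sub>R (s - t) - v = (\<gamma> s - \<gamma> t - (s - t) *\<^sub>R v) /\<^sub>R (s - t)"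
        by (simp add: scaleR_diff_right)
      then show "norm (\<gamma> s - \<gamma> t - (s - t) *\<^sub>R v) / norm (s - t) = norm ((\<gamma> s - \<gamma> t) /\<^sub>R (s - t) - v)"
        by (simp add: divide_inverse mult.commute)
    qed
    ultimately show "((\<lambda>s. norm ((\<gamma> s - \<gamma> t) /\<^sub>R (s - t) - v)) \<longlongrightarrow> 0) (at t)"
      by (rule Lim_transform_eventually)
  qed
  have cont: "\<gamma> \<midarrow>t\<rightarrow> \<gamma> t"
    using has_vector_derivative_continuous[OF \<gamma>] by (simp add: isCont_def)
  have "norm (q v) \<le> e * (K * norm v)" if e: "e > 0" for e
  proof -
    \<comment> \<open>\<open>d\<close> is a distance in the chart; since chart coordinates are
      \<open>K\<close>-Lipschitz in the position, staying within \<open>d / K\<close> of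
      \<open>\<gamma> t\<close> ensures it.\<close>
    obtain d where d: "d > 0" "\<And>w. norm (w - u) < d \<Longrightarrow> norm (q (\<phi> w) - q (\<phi> u)) \<le> e * norm (w - u)"
      using q0[OF e] by blast
    have "\<forall>\<^sub>F s in at t. dist (\<gamma> s) (\<gamma> t) < d / K"
      using tendstoD[OF cont] d(1) K(2) by simp
    with B have le: "\<forall>\<^sub>F s in at t. norm (q ((\<gamma> s - \<gamma> t) /\<^sub>R (s - t))) \<le> e * (K * norm ((\<gamma> s - \<gamma> t) /\<^sub>R (s - t)))"
    proof eventually_elim
      case (elim s)
      then obtain w where w: "w \<in> B" "\<gamma> s = \<phi> w" by auto
      have wu: "norm (w - u) \<le> K * norm (\<gamma> s - \<gamma> t)" using K(1)[OF w(1)] w(2) assms(4) by simp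
      also have "\<dots> < d" using elim(2) K(2) by (simp add: dist_norm field_simps)
      finally have "norm (q (\<gamma> s) - q (\<gamma> t)) \<le> e * norm (w - u)" using d(2) w(2) assms(4) by simp
      also have "\<dots> \<le> e * (K * norm (\<gamma> s - \<gamma> t))" using wu e by simp
      finally have "norm (q (\<gamma> s - \<gamma> t)) \<le> e * (K * norm (\<gamma> s - \<gamma> t))"
        by (simp add: bounded_linear.linear[OF q] linear_diff)
      then have "\<bar>inverse (s - t)\<bar> * norm (q (\<gamma> s - \<gamma> t)) \<le> \<bar>inverse (s - t)\<bar> * (e * (K * norm (\<gamma> s - \<gamma> t)))"
        by (rule mult_left_mono) simp
      also have "\<bar>inverse (s - t)\<bar> * norm (q (\<gamma> s - \<gamma> t)) = norm (q ((\<gamma> s - \<gamma> t) /\<^sub>R (s - t)))"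
        by (simp only: linear_cmul[OF bounded_linear.linear[OF q]] norm_scaleR)
      also have "\<bar>inverse (s - t)\<bar> * (e * (K * norm (\<gamma> s - \<gamma> t))) = e * (K * norm ((\<gamma> s - \<gamma> t) /\<^sub>R (s - t)))"
        by (simp only: norm_scaleR mult.left_commute)
      finally show ?case .
    qed
    have l1: "((\<lambda>s. norm (q ((\<gamma> s - \<gamma> t) /\<^sub>R (s - t)))) \<longlongrightarrow> norm (q v)) (at t)"
      by (intro tendsto_norm bounded_linear.tendsto[OF q] lim)
    have l2: "((\<lambda>s. e * (K * norm ((\<gamma> s - \<gamma> t) /\<^sub>R (s - t)))) \<longlongrightarrow> e * (K * norm v)) (at t)"
      by (intro tendsto_intros lim)
    show ?thesis by (rule tendsto_le[OF _ l2 l1 le]) simp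
  qed
  then have "norm (q v) \<le> 0 + e" if "e > 0" for e
  proof -
    \<comment> \<open>The added 1 keeps the denominator positive when \<open>v\<close> is 0.\<close>
    have pos: "K * norm v + 1 > 0" using K(2) by (simp add: add_nonneg_pos)
    have "norm (q v) \<le> (e / (K * norm v + 1)) * (K * norm v)"
      by (rule \<open>\<And>e. e > 0 \<Longrightarrow> norm (q v) \<le> e * (K * norm v)\<close>) (use that pos in simp)
    also have "\<dots> \<le> e" using that pos K(2) by (simp add: field_simps)
    finally show ?thesis by simp
  qed
  then have "norm (q v) \<le> 0" by (rule field_le_epsilon)
  then have "v = D (L v)" by (simp add: q_def)
  then show ?thesis by (rule range_eqI)
qed

text \<open>The derivative may be unbounded near the exceptional points. If its norm has infinite
  integral there is nothing to show; otherwise it is Lebesgue integrable, and its integral agrees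
  with the gauge integral of the fundamental theorem, which tolerates finitely many
  exceptions.\<close>

lemma norm_diff_le_nn_integral_derivative:
  fixes \<gamma> :: "real \<Rightarrow> 'a::euclidean_space"
  assumes "continuous_on {a..b} \<gamma>" "a \<le> b" "finite S"
    and der: "\<And>t. t \<in> {a<..<b} - S \<Longrightarrow> (\<gamma> has_vector_derivative \<gamma>' t) (at t)"
    and cont: "continuous_on ({a<..<b} - S) \<gamma>'"
  shows "ennreal (norm (\<gamma> b - \<gamma> a)) \<le> (\<integral>\<^sup>+t. ennreal (norm (indicator ({a<..<b} - S) t *\<^sub>R \<gamma>' t)) \<partial>lborel)"
proof -
  define w where "w = (\<lambda>t. indicator ({a<..<b} - S) t *\<^sub>R \<gamma>' t)"
  have [measurable]: "w \<in> borel_measurable borel"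
    unfolding w_def
    by (intro borel_measurable_continuous_on_indicator cont borel_open open_Diff open_greaterThanLessThan
        finite_imp_closed assms(3))
  show ?thesis
  proof (cases "(\<integral>\<^sup>+t. ennreal (norm (w t)) \<partial>lborel) = \<infinity>")
    case True
    then show ?thesis unfolding w_def by simp
  next
    case False
    then have int: "integrable lborel w"
      by (intro integrableI_bounded) (auto simp: top.not_eq_extremum)
    have "(w has_integral (\<gamma> b - \<gamma> a)) {a..b}"
    proof (rule fundamental_theorem_of_calculus_interior_strong[OF assms(3,2) _ assms(1)])
      fix t assume "t \<in> {a<..<b} - S"
      then show "(\<gamma> has_vector_derivative w t) (at t)" using der by (simp add: w_def)
    qed
    moreover have "(w has_integral integral\<^sup>L lborel w) {a..b}"
      using has_integral_integral_lborel[OF int]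
      by (subst has_integral_restrict_UNIV[symmetric], elim has_integral_eq[rotated])
        (auto simp: w_def indicator_def)
    ultimately have "\<gamma> b - \<gamma> a = integral\<^sup>L lborel w" by (rule has_integral_unique)
    then show ?thesis using integral_norm_bound_ennreal[OF int] by (simp add: w_def)
  qed
qed

text \<open>The speed is controlled only while the curve stays within \<rho> of its start, so the
  curve is cut at the first time it reaches that distance. Up to then it has already moved by
  \<rho>.\<close>

lemma curve_length_ge:
  assumes "valid_path \<gamma>" and "\<rho> > 0" "C > 0"
    and "norm (pathfinish \<gamma> - pathstart \<gamma>) \<ge> \<rho>"
    and speed: "\<And>t v. t \<in> {0<..<1} \<Longrightarrow> norm (\<gamma> t - pathstart \<gamma>) < \<rho> \<Longrightarrow>
      (\<gamma> has_vector_derivative v) (at t) \<Longrightarrow> norm v \<le> C * sqrt (g (\<gamma> t) v v)"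
  shows "ennreal \<rho> \<le> ennreal C * curve_length g \<gamma>"
proof -
  have cont: "continuous_on {0..1} \<gamma>"
    using assms(1) unfolding valid_path_def piecewise_C1_differentiable_on_def by blast
  obtain S D where S: "finite S" "\<And>t. t \<in> {0..1} - S \<Longrightarrow> (\<gamma> has_vector_derivative D t) (at t)"
    "continuous_on ({0..1} - S) D"
    using assms(1) unfolding valid_path_def piecewise_C1_differentiable_on_def C1_differentiable_on_def by blast
  \<comment> \<open>The times at distance at least \<rho> form a compact set, so there is a first
    one.\<close>
  let ?A = "{0..1} \<inter> (\<lambda>t. norm (\<gamma> t - pathstart \<gamma>)) -` {\<rho>..}"
  have "closed ?A"
    by (intro continuous_closed_preimage continuous_intros cont)
  then have "compact ?A" by (metis bounded_closed_interval bounded_Int compact_eq_bounded_closed)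
  moreover have "1 \<in> ?A" using assms(4) by (simp add: pathfinish_def)
  ultimately obtain T where T: "T \<in> ?A" "\<And>t. t \<in> ?A \<Longrightarrow> T \<le> t"
    using compact_attains_inf[of ?A] by blast
  have before: "norm (\<gamma> t - pathstart \<gamma>) < \<rho>" if "t \<in> {0<..<T}" for t
    using T(2)[of t] T(1) that by force
  let ?w = "\<lambda>t. norm (indicator ({0<..<T} - S) t *\<^sub>R D t)"
  have "continuous_on ({0<..<T} - S) D"
    by (rule continuous_on_subset[OF S(3)]) (use T(1) in auto)
  then have [measurable]: "(\<lambda>t. indicator ({0<..<T} - S) t *\<^sub>R D t) \<in> borel_measurable borel"
    by (intro borel_measurable_continuous_on_indicator borel_open open_Diff open_greaterThanLessThan
        finite_imp_closed S(1))
  have "ennreal \<rho> \<le> ennreal (norm (\<gamma> T - \<gamma> 0))"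
    using T(1) by (intro ennreal_leI) (simp add: pathstart_def)
  also have "\<dots> \<le> (\<integral>\<^sup>+t. ennreal (?w t) \<partial>lborel)"
  proof (rule norm_diff_le_nn_integral_derivative[OF _ _ S(1)])
    show "continuous_on {0..T} \<gamma>" by (rule continuous_on_subset[OF cont]) (use T(1) in auto)
    show "(\<gamma> has_vector_derivative D t) (at t)" if "t \<in> {0<..<T} - S" for t
      using S(2)[of t] that T(1) by auto
  qed (use T(1) \<open>continuous_on ({0<..<T} - S) D\<close> in auto)
  also have "\<dots> = (\<integral>\<^sup>+t. ennreal C * ennreal (?w t / C) \<partial>lborel)"
    using assms(3) by (intro nn_integral_cong) (simp flip: ennreal_mult)
  also have "\<dots> = ennreal C * (\<integral>\<^sup>+t. ennreal (?w t / C) \<partial>lborel)"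
    by (rule nn_integral_cmult) measurable
  also have "\<dots> \<le> ennreal C * curve_length g \<gamma>"
    unfolding curve_length_def
  proof (intro mult_left_mono nn_integral_mono)
    fix t
    show "ennreal (?w t / C) \<le> ennreal (sqrt (g (\<gamma> t) (vector_derivative \<gamma> (at t)) (vector_derivative \<gamma> (at t)))) * indicator {0..1} t"
    proof (cases "t \<in> {0<..<T} - S")
      case True
      then have t: "t \<in> {0<..<1}" "t \<in> {0..1} - S" using T(1) by auto
      have "norm (D t) \<le> C * sqrt (g (\<gamma> t) (D t) (D t))"
        using speed[OF t(1) _ S(2)[OF t(2)]] before True by auto
      then have "norm (D t) / C \<le> sqrt (g (\<gamma> t) (D t) (D t))" using assms(3) by (simp add: field_simps)
      then show ?thesis using True t vector_derivative_at[OF S(2)[OF t(2)]] by (simp add: ennreal_leI)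
    next
      case False
      then show ?thesis by simp
    qed
  qed simp
  finally show ?thesis .
qed

text \<open>A curve that ends at distance at least \<rho> from x must cross a chart neighbourhood on
  which Euclidean speed is at most \<open>C\<close> times Riemannian speed, which costs length at
  least \<open>\<rho> / C\<close>.\<close>

lemma geodesic_edist_lower:
  fixes X :: "(real ^ 'n::finite) set"
  assumes "riemannian_submanifold TYPE('m::finite) X g" "x \<in> X" "\<epsilon> > 0"
  shows "\<exists>\<delta>>0. \<forall>y\<in>X. geodesic_edist X g x y < ennreal \<delta> \<longrightarrow> dist x y < \<epsilon>"
proof -
  obtain U and \<phi> :: "real ^ 'm \<Rightarrow> real ^ 'n" where lp: "local_parametrization X U \<phi>" and "x \<in> \<phi> ` U"
    using assms unfolding riemannian_submanifold_def embedded_submanifold_def by blast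
  then obtain u\<^sub>0 where u\<^sub>0: "u\<^sub>0 \<in> U" "x = \<phi> u\<^sub>0" by blast
  have rm: "riemannian_metric TYPE('m) X g" using assms unfolding riemannian_submanifold_def by blast
  obtain r and L :: "real ^ 'n \<Rightarrow> real ^ 'm" where r: "r > 0" and L: "linear L" and rU: "cball u\<^sub>0 r \<subseteq> U"
    and bl: "\<And>u u'. u \<in> cball u\<^sub>0 r \<Longrightarrow> u' \<in> cball u\<^sub>0 r \<Longrightarrow> norm (u - u') \<le> 2 * norm (L (\<phi> u) - L (\<phi> u'))"
    using chart_bilipschitz[OF lp u\<^sub>0(1)] by blast
  obtain K\<^sub>0 where K0: "K\<^sub>0 > 0" "\<And>z. norm (L z) \<le> K\<^sub>0 * norm z"
    using linear_bounded_pos[OF L] by blast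
  have K: "norm (u - u') \<le> 2 * K\<^sub>0 * norm (\<phi> u - \<phi> u')" if "u \<in> cball u\<^sub>0 r" "u' \<in> cball u\<^sub>0 r" for u u'
    using bl[OF that] K0(2)[of "\<phi> u - \<phi> u'"] by (simp add: linear_diff[OF L])
  obtain C where C: "C > 0" "\<And>u \<xi>. u \<in> cball u\<^sub>0 r \<Longrightarrow>
      norm (frechet_derivative \<phi> (at u) \<xi>) \<le> C * sqrt (pullback_metric g \<phi> u \<xi> \<xi>)"
    using pullback_bounds[OF lp rm compact_cball rU] by blast
  have "openin (top_of_set X) (\<phi> ` ball u\<^sub>0 r)"
    by (rule chart_image_openin[OF lp]) (use rU in auto)
  then obtain W where W: "open W" "\<phi> ` ball u\<^sub>0 r = X \<inter> W" unfolding openin_open by blast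
  moreover have "x \<in> \<phi> ` ball u\<^sub>0 r" using u\<^sub>0 r by auto
  ultimately obtain \<rho>\<^sub>0 where \<rho>0: "\<rho>\<^sub>0 > 0" "ball x \<rho>\<^sub>0 \<subseteq> W" by (metis IntD2 openE)
  \<comment> \<open>Small enough that the part of X within \<rho> of x is covered by the chart ball
    on which \<open>C\<close> and \<open>K\<^sub>0\<close> are valid.\<close>
  define \<rho> where "\<rho> = min \<rho>\<^sub>0 \<epsilon>"
  have \<rho>: "\<rho> > 0" "\<rho> \<le> \<epsilon>" "X \<inter> ball x \<rho> \<subseteq> \<phi> ` ball u\<^sub>0 r"
    using \<rho>0 assms(3) W(2) by (auto simp: \<rho>_def)
  have len: "ennreal \<rho> \<le> ennreal C * curve_length g \<gamma>"
    if \<gamma>: "valid_path \<gamma>" "path_image \<gamma> \<subseteq> X" "pathstart \<gamma> = x" and far: "norm (pathfinish \<gamma> - x) \<ge> \<rho>" for \<gamma>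
  proof (rule curve_length_ge[OF \<gamma>(1) \<rho>(1) C(1)])
    show "\<rho> \<le> norm (pathfinish \<gamma> - pathstart \<gamma>)" using far \<gamma>(3) by simp
    fix t v assume t: "t \<in> {0<..<1}" "norm (\<gamma> t - pathstart \<gamma>) < \<rho>" and v: "(\<gamma> has_vector_derivative v) (at t)"
    have inX: "\<gamma> s \<in> X" if "s \<in> {0..1}" for s using that \<gamma>(2) by (auto simp: path_image_def)
    have "\<gamma> t \<in> X \<inter> ball x \<rho>" using t inX[of t] \<gamma>(3) by (simp add: dist_norm norm_minus_commute)
    then obtain u where u: "u \<in> ball u\<^sub>0 r" "\<gamma> t = \<phi> u" using \<rho>(3) by blast
    then have uU: "u \<in> U" using rU by auto
    have "\<gamma> \<midarrow>t\<rightarrow> \<gamma> t" using has_vector_derivative_continuous[OF v] by (simp add: isCont_def)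
    then have "\<forall>\<^sub>F s in at t. \<gamma> s \<in> ball x \<rho>"
      using \<open>\<gamma> t \<in> X \<inter> ball x \<rho>\<close> by (intro topological_tendstoD) auto
    \<comment> \<open>Outside the unit interval the curve need not lie in X, so an interior
      parameter is needed to have all nearby values in X.\<close>
    moreover have "\<forall>\<^sub>F s in at t. s \<in> {0<..<1}"
      using t(1) by (intro eventually_at_in_open') auto
    ultimately have ev: "\<forall>\<^sub>F s in at t. \<gamma> s \<in> \<phi> ` ball u\<^sub>0 r"
    proof eventually_elim
      case (elim s)
      then show ?case using \<rho>(3) inX[of s] by auto
    qed
    \<comment> \<open>Only on tangent vectors is \<open>g\<close> known to be a metric, so the
      velocity must first be pulled back to the chart.\<close>
    have "v \<in> range (frechet_derivative \<phi> (at u))"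
    proof (rule velocity_in_tangent_space[OF chart_has_derivative[OF lp uU] chart_inj[OF lp uU] v u(2) ev])
      show "norm (w - u) \<le> 2 * K\<^sub>0 * norm (\<phi> w - \<phi> u)" if "w \<in> ball u\<^sub>0 r" for w
        using K[of w u] that u(1) by auto
    qed (use K0 in simp)
    then obtain \<xi> where \<xi>: "v = frechet_derivative \<phi> (at u) \<xi>" by blast
    show "norm v \<le> C * sqrt (g (\<gamma> t) v v)"
      using C(2)[of u \<xi>] u unfolding pullback_metric_def \<xi> by auto
  qed
  show ?thesis
  proof (intro exI[of _ "\<rho> / C"] conjI ballI impI)
    show "\<rho> / C > 0" using \<rho> C by simp
    fix y assume y: "y \<in> X" "geodesic_edist X g x y < ennreal (\<rho> / C)"
    show "dist x y < \<epsilon>"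
    proof (rule ccontr)
      assume "\<not> dist x y < \<epsilon>"
      then have far: "norm (y - x) \<ge> \<rho>" using \<rho>(2) by (simp add: dist_norm norm_minus_commute)
      have "ennreal (\<rho> / C) \<le> geodesic_edist X g x y"
        unfolding geodesic_edist_def
      proof (rule INF_greatest)
        fix \<gamma> assume "\<gamma> \<in> {\<gamma>. valid_path \<gamma> \<and> path_image \<gamma> \<subseteq> X \<and> pathstart \<gamma> = x \<and> pathfinish \<gamma> = y}"
        then have "ennreal \<rho> \<le> ennreal C * curve_length g \<gamma>" using len[of \<gamma>] far by auto
        then have "ennreal C * ennreal (\<rho> / C) \<le> ennreal C * curve_length g \<gamma>"
          using C(1) \<rho>(1) by (simp flip: ennreal_mult)
        then show "ennreal (\<rho> / C) \<le> curve_length g \<gamma>"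
          using C(1) by (subst (asm) ennreal_mult_le_mult_iff) auto
      qed
      with y(2) show False by simp
    qed
  qed
qed

text \<open>The chart image of a straight segment inside a ball of radius \<open>r\<close> has
  length at most \<open>C * r\<close>.\<close>

lemma geodesic_edist_upper:
  fixes X :: "(real ^ 'n::finite) set"
  assumes "riemannian_submanifold TYPE('m::finite) X g" "x \<in> X" "\<epsilon> > 0"
  shows "\<exists>\<delta>>0. \<forall>y\<in>X. dist x y < \<delta> \<longrightarrow> geodesic_edist X g x y < ennreal \<epsilon>"
proof -
  obtain U and \<phi> :: "real ^ 'm \<Rightarrow> real ^ 'n" where lp: "local_parametrization X U \<phi>" and "x \<in> \<phi> ` U"
    using assms unfolding riemannian_submanifold_def embedded_submanifold_def by blast
  then obtain u\<^sub>0 where u\<^sub>0: "u\<^sub>0 \<in> U" "x = \<phi> u\<^sub>0" by blast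
  have rm: "riemannian_metric TYPE('m) X g" using assms unfolding riemannian_submanifold_def by blast
  obtain r\<^sub>0 where r0: "r\<^sub>0 > 0" "cball u\<^sub>0 r\<^sub>0 \<subseteq> U"
    using chart_open[OF lp] u\<^sub>0(1) open_contains_cball by blast
  obtain C where C: "C > 0" "\<And>u \<xi>. u \<in> cball u\<^sub>0 r\<^sub>0 \<Longrightarrow> sqrt (pullback_metric g \<phi> u \<xi> \<xi>) \<le> C * norm \<xi>"
    using pullback_bounds[OF lp rm compact_cball r0(2)] by blast
  \<comment> \<open>The 2 makes \<open>C * r\<close> strictly smaller than \<epsilon>.\<close>
  define r where "r = min r\<^sub>0 (\<epsilon> / (2 * C))"
  have r: "r > 0" "r \<le> r\<^sub>0" "C * r < \<epsilon>" using r0 C assms(3) by (auto simp: r_def min_def field_simps)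
  have "openin (top_of_set X) (\<phi> ` ball u\<^sub>0 r)"
    by (rule chart_image_openin[OF lp]) (use r0 r in auto)
  then obtain W where W: "open W" "\<phi> ` ball u\<^sub>0 r = X \<inter> W" unfolding openin_open by blast
  moreover have "x \<in> \<phi> ` ball u\<^sub>0 r" using u\<^sub>0 r by auto
  ultimately obtain \<delta> where \<delta>: "\<delta> > 0" "ball x \<delta> \<subseteq> W" by (metis IntD2 openE)
  have "geodesic_edist X g x y < ennreal \<epsilon>" if y: "y \<in> X" "dist x y < \<delta>" for y
  proof -
    have "y \<in> \<phi> ` ball u\<^sub>0 r" using y \<delta> W(2) by auto
    then obtain u where u: "u \<in> ball u\<^sub>0 r" "y = \<phi> u" by blast
    define l where "l = linepath u\<^sub>0 u"
    define \<gamma> where "\<gamma> = (\<lambda>t. \<phi> (l t))"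
    have l: "l t \<in> ball u\<^sub>0 r" if "t \<in> {0..1}" for t
    proof -
      have "closed_segment u\<^sub>0 u \<subseteq> ball u\<^sub>0 r"
        using u r(1) by (intro closed_segment_subset) auto
      then show ?thesis using that unfolding l_def by (metis linepath_image_01 image_eqI subsetD)
    qed
    then have lU: "l t \<in> U" "l t \<in> cball u\<^sub>0 r\<^sub>0" if "t \<in> {0..1}" for t
      using that r0 r by (force simp: subset_iff)+
    define D where "D = (\<lambda>t. frechet_derivative \<phi> (at (l t)) (u - u\<^sub>0))"
    have der: "(\<gamma> has_vector_derivative D t) (at t)" if "t \<in> {0..1}" for t
    proof -
      have "(l has_derivative (\<lambda>h. h *\<^sub>R (u - u\<^sub>0))) (at t)"
        using has_vector_derivative_linepath_within[of u\<^sub>0 u t UNIV] unfolding l_def has_vector_derivative_def .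
      then have "(\<gamma> has_derivative (\<lambda>h. frechet_derivative \<phi> (at (l t)) (h *\<^sub>R (u - u\<^sub>0)))) (at t)"
        unfolding \<gamma>_def by (rule has_derivative_compose) (rule chart_has_derivative[OF lp lU(1)[OF that]])
      then show ?thesis
        unfolding has_vector_derivative_def D_def by (simp add: linear_cmul[OF chart_linear[OF lp lU(1)[OF that]]])
    qed
    have "continuous_on {0..1} D"
      unfolding D_def
      by (rule continuous_on_compose2[OF smooth_on_continuous_derivative[OF chart_smooth[OF lp]]])
        (use lU in \<open>auto simp: l_def\<close>)
    then have "\<gamma> C1_differentiable_on {0..1}"
      unfolding C1_differentiable_on_def using der by blast
    then have "valid_path \<gamma>"
      unfolding valid_path_def by (rule C1_differentiable_imp_piecewise)
    moreover have "path_image \<gamma> \<subseteq> X"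
      using lU(1) chart_subset[OF lp] by (auto simp: path_image_def \<gamma>_def)
    moreover have "pathstart \<gamma> = x" "pathfinish \<gamma> = y"
      using u\<^sub>0 u by (auto simp: \<gamma>_def l_def pathstart_def pathfinish_def linepath_def)
    ultimately have "geodesic_edist X g x y \<le> curve_length g \<gamma>"
      unfolding geodesic_edist_def by (intro INF_lower) simp
    also have "\<dots> \<le> (\<integral>\<^sup>+t\<in>{0..1::real}. ennreal (C * r) \<partial>lborel)"
      unfolding curve_length_def
    proof (rule nn_integral_mono)
      fix t :: real
      show "ennreal (sqrt (g (\<gamma> t) (vector_derivative \<gamma> (at t)) (vector_derivative \<gamma> (at t)))) * indicator {0..1} t
        \<le> ennreal (C * r) * indicator {0..1} t"
      proof (cases "t \<in> {0..1}")
        case True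
        have "sqrt (g (\<gamma> t) (D t) (D t)) \<le> C * norm (u - u\<^sub>0)"
          using C(2)[OF lU(2)[OF True], of "u - u\<^sub>0"] by (simp add: pullback_metric_def D_def \<gamma>_def)
        also have "\<dots> \<le> C * r" using C(1) u(1) by (simp add: dist_norm norm_minus_commute)
        finally show ?thesis using True vector_derivative_at[OF der[OF True]] by (simp add: ennreal_leI)
      qed simp
    qed
    also have "\<dots> = ennreal (C * r)" by (simp add: nn_integral_cmult_indicator)
    also have "\<dots> < ennreal \<epsilon>" using r C assms(3) by (intro ennreal_lessI) auto
    finally show ?thesis .
  qed
  then show ?thesis using \<delta>(1) by blast
qed

text \<open>The two preceding estimates say that geodesic balls and Euclidean boxes around a point
  of X contain one another in X.\<close>

lemma thick_iff_box:
  fixes X :: "(real ^ 'n::finite) set"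
  assumes rs: "riemannian_submanifold TYPE('m::finite) X g"
    and fin: "\<forall>x\<in>X. \<forall>y\<in>X. geodesic_edist X g x y < \<infinity>"
    and ms: "Metric_space X (geodesic_dist X g)" and A: "A \<subseteq> X"
  shows "thick X (geodesic_dist X g) A \<longleftrightarrow> (\<exists>l r. X \<inter> box l r \<noteq> {} \<and> X \<inter> box l r \<subseteq> A)"
proof -
  interpret Metric_space X "geodesic_dist X g" by (rule ms)
  \<comment> \<open>Finiteness is essential: \<open>enn2real\<close> sends infinity to 0.\<close>
  have edist: "geodesic_dist X g x y < \<delta> \<longleftrightarrow> geodesic_edist X g x y < ennreal \<delta>"
    if "x \<in> X" "y \<in> X" "\<delta> > 0" for x y \<delta>
  proof -
    have "geodesic_edist X g x y = ennreal (geodesic_dist X g x y)"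
      using fin that unfolding geodesic_dist_def by (simp add: less_top)
    then show ?thesis by (simp only: ennreal_less_iff[OF nonneg])
  qed
  show ?thesis
  proof
    assume "thick X (geodesic_dist X g) A"
    then obtain c s y where y: "y \<in> mball c s" and sub: "mball c s \<subseteq> A" unfolding thick_def by blast
    \<comment> \<open>The estimates concern balls around a given point, so the ball is replaced by a
      smaller one centred at its element \<open>y\<close>.\<close>
    obtain s' where s': "s' > 0" "mball y s' \<subseteq> mball c s"
      using openin_mball[of c s] y unfolding openin_mtopology by blast
    have yX: "y \<in> X" using y by (simp add: in_mball)
    obtain \<delta> where \<delta>: "\<delta> > 0" "\<And>z. z \<in> X \<Longrightarrow> dist y z < \<delta> \<Longrightarrow> geodesic_edist X g y z < ennreal s'"
      using geodesic_edist_upper[OF rs yX s'(1)] by blast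
    obtain l r where lr: "y \<in> box l r" "box l r \<subseteq> ball y \<delta>" using rational_boxes[OF \<delta>(1)] by blast
    have "X \<inter> box l r \<subseteq> mball y s'"
      using lr(2) \<delta>(2) edist[OF yX _ s'(1)] yX by (auto simp: in_mball subset_iff)
    then show "\<exists>l r. X \<inter> box l r \<noteq> {} \<and> X \<inter> box l r \<subseteq> A"
      using lr(1) yX s'(2) sub by blast
  next
    assume "\<exists>l r. X \<inter> box l r \<noteq> {} \<and> X \<inter> box l r \<subseteq> A"
    then obtain l r x where x: "x \<in> X" "x \<in> box l r" and sub: "X \<inter> box l r \<subseteq> A" by blast
    obtain e where e: "e > 0" "ball x e \<subseteq> box l r" using x(2) open_box openE by blast
    obtain \<delta> where \<delta>: "\<delta> > 0" "\<And>z. z \<in> X \<Longrightarrow> geodesic_edist X g x z < ennreal \<delta> \<Longrightarrow> dist x z < e"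
      using geodesic_edist_lower[OF rs x(1) e(1)] by blast
    have "mball x \<delta> \<subseteq> A"
      using \<delta>(2) edist[OF x(1) _ \<delta>(1)] e(2) sub by (force simp: in_mball subset_iff)
    moreover have "x \<in> mball x \<delta>" using x(1) \<delta>(1) by simp
    ultimately show "thick X (geodesic_dist X g) A" unfolding thick_def by blast
  qed
qed

section \<open>Definable subsets of Euclidean space\<close>

abbreviation index :: "nat \<Rightarrow> 'n::finite" where
  "index \<equiv> from_nat_into UNIV"

lemma bij_index: "bij_betw (index :: nat \<Rightarrow> 'n::finite) {..<CARD('n)} UNIV"
  by (rule bij_betw_from_nat_into_finite) simp

lemma ball_index: "(\<forall>v<CARD('n::finite). P (index v :: 'n)) \<longleftrightarrow> (\<forall>k. P k)"
proof (intro iffI allI)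
  fix k :: 'n assume *: "\<forall>v<CARD('n). P (index v :: 'n)"
  have "k \<in> index ` {..<CARD('n)}" using bij_index[where 'n = 'n] by (simp add: bij_betw_def)
  then show "P k" using * by auto
qed auto

lemma mem_box_index:
  fixes x :: "real ^ 'n::finite"
  shows "x \<in> box l r \<longleftrightarrow> (\<forall>v<CARD('n). l $ index v < x $ index v \<and> x $ index v < r $ index v)"
  using ball_index[of "\<lambda>k. l $ k < x $ k \<and> x $ k < r $ k"] by (simp add: mem_box_cart)

lemma vec_eq_index:
  fixes x :: "real ^ 'n::finite"
  shows "x = y \<longleftrightarrow> (\<forall>v<CARD('n). x $ index v = y $ index v)"
  using ball_index[of "\<lambda>k. x $ k = y $ k"] by (simp add: vec_eq_iff)

lemma index_eq_iff: "v < CARD('n::finite) \<Longrightarrow> w < CARD('n) \<Longrightarrow> (index v :: 'n) = index w \<longleftrightarrow> v = w"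
  using bij_index[where 'n = 'n] unfolding bij_betw_def inj_on_def by auto

lemma ex_vec_index: "\<exists>x :: real ^ 'n::finite. \<forall>v<CARD('n). x $ index v = f v"
proof -
  let ?i = "the_inv_into {..<CARD('n)} (index :: nat \<Rightarrow> 'n)"
  have "?i (index v) = v" if "v < CARD('n)" for v
    using that bij_index[where 'n = 'n] by (intro the_inv_into_f_f) (auto simp: bij_betw_def)
  then show ?thesis by (intro exI[of _ "\<chi> k. f (?i k)"]) simp
qed

lemma linear_index_expansion:
  fixes L :: "real ^ 'n::finite \<Rightarrow> real ^ 'm::finite"
  assumes "linear L"
  shows "L x $ i = (\<Sum>j<CARD('n). L (axis (index j) 1) $ i * x $ index j)"
proof -
  have "L x = L (\<Sum>k\<in>UNIV. x $ k *\<^sub>R axis k 1)"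
    using basis_expansion[of x] by (simp add: scalar_mult_eq_scaleR)
  also have "\<dots> = (\<Sum>k\<in>UNIV. x $ k *\<^sub>R L (axis k 1))"
    using assms by (simp add: linear_sum linear_cmul)
  finally have "L x $ i = (\<Sum>k\<in>UNIV. x $ k * L (axis k 1) $ i)" by simp
  also have "\<dots> = (\<Sum>j<CARD('n). x $ index j * L (axis (index j) 1) $ i)"
    by (rule sum.reindex_bij_betw[symmetric, OF bij_index])
  finally show ?thesis by (simp add: mult.commute)
qed

lemma coords_index:
  fixes c :: "nat \<Rightarrow> real ^ 'n::finite"
  shows "v < CARD('n) \<Longrightarrow> coords c v = c 0 $ index v"
    and "v < CARD('n) \<Longrightarrow> coords c (CARD('n) + v) = c 1 $ index v"
  by (simp_all add: coords_def)

text \<open>Unpacks the encoding by 1-tuples. The predicate ignores all variables from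
  \<open>CARD('n)\<close> on, which leaves them available for other coordinates.\<close>

lemma definable_set_param_pred:
  fixes D :: "(real ^ 'n::finite) set"
  assumes "definable_set M D"
  obtains P where "param_pred M P"
    "\<And>x e. (\<And>v. v < CARD('n) \<Longrightarrow> e v = x $ index v) \<Longrightarrow> P e \<longleftrightarrow> x \<in> D"
proof -
  obtain p b where p: "wf_fm M p" and
    D: "({..<1} \<rightarrow>\<^sub>E D) = {c \<in> {..<1} \<rightarrow>\<^sub>E UNIV. sat M (\<lambda>v. if v < 1 * CARD('n) then coords c v else b v) p}"
    using assms unfolding definable_set_def definable_def by blast
  let ?P = "\<lambda>e. sat M (\<lambda>v. if v < CARD('n) then e v else b v) p"
  have "?P e \<longleftrightarrow> x \<in> D" if e: "\<And>v. v < CARD('n) \<Longrightarrow> e v = x $ index v" for x e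
  proof -
    let ?c = "\<lambda>i\<in>{..<1::nat}. x"
    have "x \<in> D \<longleftrightarrow> ?c \<in> ({..<1} \<rightarrow>\<^sub>E D)" by (auto simp: PiE_iff)
    also have "\<dots> \<longleftrightarrow> sat M (\<lambda>v. if v < 1 * CARD('n) then coords ?c v else b v) p"
    proof -
      have "?c \<in> {..<1} \<rightarrow>\<^sub>E UNIV" by auto
      then show ?thesis unfolding D mem_Collect_eq by (simp only: simp_thms)
    qed
    also have "(\<lambda>v. if v < 1 * CARD('n) then coords ?c v else b v) = (\<lambda>v. if v < CARD('n) then e v else b v)"
      using e by (auto simp: coords_index)
    finally show ?thesis by simp
  qed
  with param_pred_sat[OF p] show ?thesis by (rule that)
qed

lemma definable_set_borel:
  fixes D :: "(real ^ 'n::finite) set"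
  assumes "o_minimal M" "definable_set M D"
  shows "D \<in> sets borel"
proof -
  obtain P where P: "param_pred M P"
    "\<And>x e. (\<And>v. v < CARD('n) \<Longrightarrow> e v = x $ index v) \<Longrightarrow> P e \<longleftrightarrow> x \<in> D"
    by (rule definable_set_param_pred[OF assms(2)]) blast
  have "Measurable.pred borel (\<lambda>x :: real ^ 'n. P (\<lambda>v. if v \<in> {..<CARD('n)} then (\<lambda>x v. x $ index v) x v else 0))"
    by (rule param_pred_measurable[OF assms(1) _ P(1)]) auto
  moreover have "P (\<lambda>v. if v \<in> {..<CARD('n)} then (\<lambda>x v. x $ index v) x v else 0) \<longleftrightarrow> x \<in> D" for x
    by (rule P(2)) simp
  ultimately show ?thesis by (simp add: pred_def)
qed

lemma definable_measurable:
  fixes \<mu> :: "(real ^ 'n::finite) measure"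
  assumes "o_minimal M" and sets: "sets \<mu> = sets (restrict_space borel X)"
    and D: "D \<subseteq> ({..<k} \<rightarrow>\<^sub>E X)" "definable M k D"
  shows "D \<in> sets (Pi\<^sub>M {..<k} (\<lambda>_. \<mu>))"
proof -
  obtain p b where p: "wf_fm M p" and
    eq: "D = {c \<in> {..<k} \<rightarrow>\<^sub>E UNIV. sat M (\<lambda>v. if v < k * CARD('n) then coords c v else b v) p}"
    using D(2) unfolding definable_def by blast
  let ?N = "Pi\<^sub>M {..<k} (\<lambda>_. \<mu>)"
  have space: "space ?N = ({..<k} \<rightarrow>\<^sub>E X)"
    using sets_eq_imp_space_eq[OF sets] by (simp add: space_PiM space_restrict_space)
  have [measurable]: "(\<lambda>x. x) \<in> measurable \<mu> borel"
    unfolding measurable_cong_sets[OF sets refl]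
    using measurable_restrict_space1[OF measurable_ident, of borel X] by (simp add: id_def)
  have [measurable]: "(\<lambda>c. coords c v) \<in> borel_measurable ?N" if "v \<in> {..<k * CARD('n)}" for v
  proof -
    have "v div CARD('n) \<in> {..<k}" using that by (simp add: less_mult_imp_div_less)
    then have "(\<lambda>c. c (v div CARD('n))) \<in> measurable ?N \<mu>" by (rule measurable_component_singleton)
    from measurable_compose[OF this \<open>(\<lambda>x. x) \<in> measurable \<mu> borel\<close>]
    have "(\<lambda>c. c (v div CARD('n))) \<in> borel_measurable ?N" .
    moreover have "(\<lambda>x :: real ^ 'n. x $ i) \<in> borel_measurable borel" for i by auto
    ultimately show ?thesis unfolding coords_def by (rule measurable_compose)
  qed
  \<comment> \<open>The inner conditional repeats the outer one to match the shape required by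
    \<open>param_pred_measurable\<close>.\<close>
  have "Measurable.pred ?N (\<lambda>c. sat M (\<lambda>v. if v < k * CARD('n) then
      (if v \<in> {..<k * CARD('n)} then coords c v else b v) else b v) p)"
    by (rule param_pred_measurable[OF assms(1) _ param_pred_sat[OF p]]) auto
  then have "{c \<in> space ?N. sat M (\<lambda>v. if v < k * CARD('n) then coords c v else b v) p} \<in> sets ?N"
    by (simp add: pred_def cong: if_cong)
  also have "{c \<in> space ?N. sat M (\<lambda>v. if v < k * CARD('n) then coords c v else b v) p} = D"
    using D(1) unfolding space eq by (auto simp: PiE_iff)
  finally show ?thesis .
qed

text \<open>The image under \<open>L\<close> is the projection of its graph over
  \<open>D \<inter> box l r\<close>, hence definable, and \<open>param_pred_null_or_box\<close>
  applies.\<close>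

lemma linear_image_definable_null_or_interior:
  fixes L :: "real ^ 'n::finite \<Rightarrow> real ^ 'm::finite"
  assumes "o_minimal M" "definable_set M D" and L: "linear L"
  shows "L ` (D \<inter> box l r) \<in> null_sets lborel \<or> interior (L ` (D \<inter> box l r)) \<noteq> {}"
proof -
  obtain P where P: "param_pred M P"
    "\<And>x e. (\<And>v. v < CARD('n) \<Longrightarrow> e v = x $ index v) \<Longrightarrow> P e \<longleftrightarrow> x \<in> D"
    by (rule definable_set_param_pred[OF assms(2)]) blast
  define n where "n = CARD('n)"
  \<comment> \<open>Variables below \<open>n\<close> hold the coordinates of a point of
    \<open>D\<close>; those in \<open>V\<close> hold the coordinates of its image.\<close>
  define V where "V = {n..<n + CARD('m)}"
  define Q where "Q = (\<lambda>e. P e \<and> (\<forall>j\<in>{..<n}. l $ index j < e j \<and> e j < r $ index j) \<and>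
      (\<forall>i\<in>{..<CARD('m)}. e (n + i) = (\<Sum>j<n. L (axis (index j) 1) $ index i * e j)))"
  have Q: "param_pred M Q"
    unfolding Q_def
    by (intro param_pred.conj P(1) param_pred.ball finite_lessThan param_pred_less_const
        param_pred_greater_const param_pred_linear)
  define I where "I = (\<lambda>e. \<exists>f. Q (\<lambda>v. if v \<in> {..<n} then f v else e v))"
  have I: "param_pred M I" unfolding I_def by (intro param_pred.ex_block Q finite_lessThan)
  have I_iff: "I e \<longleftrightarrow> z \<in> L ` (D \<inter> box l r)"
    if e: "\<And>i. i < CARD('m) \<Longrightarrow> e (n + i) = z $ index i" for e z
  proof -
    have main: "Q (\<lambda>v. if v \<in> {..<n} then f v else e v) \<longleftrightarrow> x \<in> D \<and> x \<in> box l r \<and> z = L x"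
      if x: "\<And>v. v < n \<Longrightarrow> x $ index v = f v" for f x
    proof -
      let ?e = "\<lambda>v. if v \<in> {..<n} then f v else e v"
      have 1: "P ?e \<longleftrightarrow> x \<in> D" by (rule P(2)) (simp add: x n_def[symmetric])
      have 2: "(\<forall>j\<in>{..<n}. l $ index j < ?e j \<and> ?e j < r $ index j) \<longleftrightarrow> x \<in> box l r"
        unfolding mem_box_index using x by (auto simp: n_def)
      have "(\<Sum>j<n. L (axis (index j) 1) $ k * ?e j) = L x $ k" for k
        by (subst linear_index_expansion[OF L, of x k], unfold n_def[symmetric], rule sum.cong) (auto simp: x)
      then have 3: "(\<forall>i\<in>{..<CARD('m)}. ?e (n + i) = (\<Sum>j<n. L (axis (index j) 1) $ index i * ?e j))
          \<longleftrightarrow> z = L x"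
        unfolding vec_eq_index using e by auto
      show ?thesis unfolding Q_def 1 2 3 by simp
    qed
    show ?thesis
    proof
      assume "I e"
      then obtain f where f: "Q (\<lambda>v. if v \<in> {..<n} then f v else e v)" unfolding I_def by blast
      obtain x :: "real ^ 'n" where "\<forall>v<n. x $ index v = f v" using ex_vec_index n_def by blast
      then show "z \<in> L ` (D \<inter> box l r)" using main[of x f] f by blast
    next
      assume "z \<in> L ` (D \<inter> box l r)"
      then obtain x where "x \<in> D" "x \<in> box l r" "z = L x" by blast
      then have "Q (\<lambda>v. if v \<in> {..<n} then x $ index v else e v)"
        using main[of x "\<lambda>v. x $ index v"] by blast
      then show "I e" unfolding I_def by (rule exI[of _ "\<lambda>v. x $ index v"])
    qed
  qed
  let ?A = "L ` (D \<inter> box l r)"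
  have "Measurable.pred borel (\<lambda>z :: real ^ 'm. I (\<lambda>v. if v \<in> V then (\<lambda>z v. z $ index (v - n)) z v else 0))"
    by (rule param_pred_measurable[OF assms(1) _ I]) (auto simp: V_def)
  moreover have "I (\<lambda>v. if v \<in> V then (\<lambda>z v. z $ index (v - n)) z v else 0) \<longleftrightarrow> z \<in> ?A" for z
    by (rule I_iff) (simp add: V_def)
  ultimately have A: "?A \<in> sets borel" by (simp add: pred_def)
  \<comment> \<open>Sends the variable of the i-th image coordinate to the corresponding basis
    vector.\<close>
  define s :: "nat \<Rightarrow> real ^ 'm" where "s = (\<lambda>v. axis (index (v - n)) 1)"
  have inj: "inj_on s V"
    unfolding s_def V_def inj_on_def by (auto simp: axis_eq_axis index_eq_iff)
  have sV: "s ` V = Basis"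
  proof -
    have "s ` V = (\<lambda>k. axis k 1) ` index ` {..<CARD('m)}"
    proof -
      have "V = (\<lambda>i. n + i) ` {..<CARD('m)}"
        unfolding V_def by (simp add: lessThan_atLeast0 image_add_atLeastLessThan add.commute)
      then show ?thesis unfolding s_def by (simp add: image_image)
    qed
    also have "index ` {..<CARD('m)} = (UNIV :: 'm set)" using bij_index unfolding bij_betw_def by blast
    finally show ?thesis by (auto simp: Basis_vec_def)
  qed
  show ?thesis
  proof (rule disjCI)
    assume "\<not> interior ?A \<noteq> {}"
    then have int: "interior ?A = {}" by simp
    have "emeasure lborel ?A = 0"
    proof (rule ccontr)
      assume nz: "emeasure lborel ?A \<noteq> 0"
      let ?N = "Pi\<^sub>M Basis (\<lambda>_. lborel) :: (real ^ 'm \<Rightarrow> real) measure"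
      let ?T = "\<lambda>f :: real ^ 'm \<Rightarrow> real. \<Sum>b\<in>Basis. f b *\<^sub>R b"
      \<comment> \<open>By construction \<open>lborel\<close> is the image of the product measure
        over \<open>Basis\<close> under summation of basis multiples.\<close>
      have "emeasure lborel ?A = emeasure ?N (?T -` ?A \<inter> space ?N)"
        by (subst lborel_eq, subst emeasure_distr) (use A in auto)
      also have "?T -` ?A \<inter> space ?N = {f \<in> space ?N. I (\<lambda>v. if v \<in> V then f (s v) else 0)}"
      proof -
        have "I (\<lambda>v. if v \<in> V then f (s v) else 0) \<longleftrightarrow> ?T f \<in> ?A" for f
        proof (rule I_iff)
          fix i assume i: "i < CARD('m)"
          have "axis (index i) 1 \<in> (Basis :: (real ^ 'm) set)" by (auto simp: Basis_vec_def)
          then have "?T f $ index i = f (axis (index i) 1)"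
            by (simp add: cart_eq_inner_axis inner_sum_left_Basis)
          then show "(if n + i \<in> V then f (s (n + i)) else 0) = ?T f $ index i"
            using i by (simp add: V_def s_def)
        qed
        then show ?thesis by auto
      qed
      finally have "emeasure ?N {f \<in> space ?N. I (\<lambda>v. if v \<in> V then f (s v) else 0)} \<noteq> 0"
        using nz by simp
      then obtain a c where ac: "\<forall>v\<in>V. a v < c v"
        "\<And>y. \<forall>v\<in>V. a v < y v \<and> y v < c v \<Longrightarrow> I (\<lambda>v. if v \<in> V then y v else 0)"
        using param_pred_null_or_box[OF assms(1) _ inj I, of "\<lambda>_. 0"] unfolding sV by (auto simp: V_def)
      obtain a' c' :: "real ^ 'm" where a': "\<And>i. i < CARD('m) \<Longrightarrow> a' $ index i = a (n + i)"
        and c': "\<And>i. i < CARD('m) \<Longrightarrow> c' $ index i = c (n + i)"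
        using ex_vec_index[of "\<lambda>i. a (n + i)"] ex_vec_index[of "\<lambda>i. c (n + i)"] by metis
      have "box a' c' \<subseteq> ?A"
      proof
        fix z assume z: "z \<in> box a' c'"
        have "I (\<lambda>v. if v \<in> V then z $ index (v - n) else 0)"
        proof (rule ac(2), intro ballI)
          fix v assume "v \<in> V"
          then obtain i where i: "v = n + i" "i < CARD('m)" unfolding V_def
            by (metis add_less_cancel_left atLeastLessThan_iff le_iff_add)
          then show "a v < z $ index (v - n) \<and> z $ index (v - n) < c v"
            using z a' c' unfolding mem_box_index by simp
        qed
        moreover have "I (\<lambda>v. if v \<in> V then z $ index (v - n) else 0) \<longleftrightarrow> z \<in> ?A"
          by (rule I_iff) (simp add: V_def)
        ultimately show "z \<in> ?A" by simp
      qed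
      then have "box a' c' \<subseteq> interior ?A" by (simp add: interior_maximal open_box)
      moreover have "box a' c' \<noteq> {}"
      proof -
        have "\<forall>v<CARD('m). a' $ index v < c' $ index v" using ac(1) a' c' by (simp add: V_def)
        then have "(1/2) *\<^sub>R (a' + c') \<in> box a' c'" unfolding mem_box_index by (auto simp: field_simps)
        then show ?thesis by blast
      qed
      ultimately show False using int by simp
    qed
    then show "?A \<in> null_sets lborel" using A by (intro null_setsI) auto
  qed
qed

section \<open>The volume of definable sets, and definability of thickness\<close>

text \<open>The determinant does not vanish on the segment from the identity matrix to \<open>A\<close>.\<close>

lemma det_pos_of_positive_definite:
  fixes A :: "real ^ 'm::finite ^ 'm"
  assumes "\<And>x. x \<noteq> 0 \<Longrightarrow> x \<bullet> (A *v x) > 0"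
  shows "det A > 0"
proof (rule ccontr)
  assume "\<not> det A > 0"
  define f where "f = (\<lambda>s. det ((1 - s) *\<^sub>R mat 1 + s *\<^sub>R A))"
  have "f 0 = 1" "f 1 = det A" by (simp_all add: f_def)
  moreover have "continuous_on {0..1} f"
    unfolding f_def det_def by (auto intro!: continuous_intros)
  ultimately obtain s where s: "0 \<le> s" "s \<le> 1" "f s = 0"
    using IVT2'[of f 1 0 0] \<open>\<not> det A > 0\<close> by auto
  let ?B = "(1 - s) *\<^sub>R mat 1 + s *\<^sub>R A"
  have "x = 0" if "?B *v x = 0" for x
  proof (rule ccontr)
    assume x: "x \<noteq> 0"
    have "?B *v x = (1 - s) *\<^sub>R x + s *\<^sub>R (A *v x)"
      by (simp add: matrix_vector_mult_add_rdistrib flip: scaleR_matrix_vector_assoc)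
    then have "x \<bullet> (?B *v x) = (1 - s) * (x \<bullet> x) + s * (x \<bullet> (A *v x))"
      by (simp add: inner_add_right)
    also have "\<dots> > 0"
    proof (cases "s = 0")
      case True
      then show ?thesis using x by simp
    next
      case False
      then have "s * (x \<bullet> (A *v x)) > 0" using s(1) assms[OF x] by simp
      then show ?thesis using s(2) by (intro add_nonneg_pos) auto
    qed
    finally show False using that by simp
  qed
  then have "invertible ?B" unfolding invertible_left_inverse matrix_left_invertible_ker by blast
  then show False using s(3) by (simp add: invertible_det_nz f_def)
qed

text \<open>The quadratic form of the Gram matrix is the metric itself, so the matrix is positive
  definite. This makes the volume density strictly positive.\<close>

lemma gram_det_pos:
  fixes X :: "(real ^ 'n::finite) set" and \<phi> :: "real ^ 'm::finite \<Rightarrow> real ^ 'n"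
  assumes "local_parametrization X U \<phi>" "riemannian_metric TYPE('m) X g" "u \<in> U"
  shows "det (\<chi> i j. pullback_metric g \<phi> u (axis i 1) (axis j 1)) > 0"
proof (rule det_pos_of_positive_definite)
  fix x :: "real ^ 'm" assume "x \<noteq> 0"
  let ?G = "pullback_metric g \<phi> u"
  have b: "bilinear ?G" by (rule pullback_bilinear[OF assms])
  have x: "x = (\<Sum>i\<in>UNIV. x $ i *\<^sub>R axis i 1)"
    using basis_expansion[of x] by (simp add: scalar_mult_eq_scaleR)
  have "?G x x = ?G (\<Sum>i\<in>UNIV. x $ i *\<^sub>R axis i 1) (\<Sum>i\<in>UNIV. x $ i *\<^sub>R axis i 1)" using x by simp
  also have "\<dots> = (\<Sum>(i, j)\<in>UNIV \<times> UNIV. x $ i * (x $ j * ?G (axis i 1) (axis j 1)))"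
    by (subst bilinear_sum[OF b]) (auto intro!: sum.cong simp: bilinear_lmul[OF b] bilinear_rmul[OF b])
  also have "\<dots> = (\<Sum>i\<in>UNIV. \<Sum>j\<in>UNIV. x $ i * (x $ j * ?G (axis i 1) (axis j 1)))"
    by (rule sum.cartesian_product[symmetric])
  also have "\<dots> = x \<bullet> ((\<chi> i j. ?G (axis i 1) (axis j 1)) *v x)"
    by (simp add: inner_vec_def matrix_vector_mult_def sum_distrib_left mult.commute[of "?G _ _"])
  finally show "x \<bullet> ((\<chi> i j. ?G (axis i 1) (axis j 1)) *v x) > 0"
    using pullback_pos[OF assms \<open>x \<noteq> 0\<close>] by simp
qed

lemma openin_sets_restrict_borel:
  assumes "openin (top_of_set X) A"
  shows "A \<in> sets (restrict_space borel X)"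
proof -
  obtain T where "open T" "A = X \<inter> T" using assms unfolding openin_open by blast
  then show ?thesis unfolding sets_restrict_space by (metis borel_open imageI)
qed

lemma riemannian_volume_chart:
  fixes \<phi> :: "real ^ 'm::finite \<Rightarrow> real ^ 'n::finite"
  assumes "riemannian_volume TYPE('m) X g V" "local_parametrization X U \<phi>" "A \<in> sets V" "A \<subseteq> \<phi> ` U"
  shows "emeasure V A = (\<integral>\<^sup>+ u \<in> U \<inter> \<phi> -` A.
    ennreal (sqrt (det (\<chi> i j. pullback_metric g \<phi> u (axis i 1) (axis j 1)))) \<partial>lborel)"
  by (rule conjunct2[OF assms(1)[unfolded riemannian_volume_def], THEN spec, THEN spec, THEN spec,
        THEN mp, OF conjI[OF assms(2) conjI[OF assms(3,4)]]])

text \<open>A positive continuous density has zero integral over an open set only if the set is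
  negligible, hence empty.\<close>

lemma volume_chart_image_pos:
  fixes X :: "(real ^ 'n::finite) set" and \<phi> :: "real ^ 'm::finite \<Rightarrow> real ^ 'n"
  assumes lp: "local_parametrization X U \<phi>" and rm: "riemannian_metric TYPE('m) X g"
    and V: "riemannian_volume TYPE('m) X g V" and O: "open O'" "O' \<subseteq> U" "O' \<noteq> {}"
  shows "emeasure V (\<phi> ` O') > 0"
proof -
  define h where "h = (\<lambda>u. sqrt (det (\<chi> i j. pullback_metric g \<phi> u (axis i 1) (axis j 1))))"
  have "\<phi> ` O' \<in> sets V"
    using V openin_sets_restrict_borel[OF chart_image_openin[OF lp O(1,2)]]
    unfolding riemannian_volume_def by blast
  moreover have "\<phi> ` O' \<subseteq> \<phi> ` U" using O(2) by blast
  \<comment> \<open>Injectivity of the chart: no point outside \<open>O'\<close> is mapped into its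
    image.\<close>
  moreover have "U \<inter> \<phi> -` \<phi> ` O' = O'"
    using O(2) chart_inj_on[OF lp] by (auto dest: inj_onD)
  ultimately have eq: "emeasure V (\<phi> ` O') = (\<integral>\<^sup>+u\<in>O'. ennreal (h u) \<partial>lborel)"
    using riemannian_volume_chart[OF V lp, of "\<phi> ` O'"] unfolding h_def by simp
  have "continuous_on O' h"
    unfolding h_def det_def
    by (auto intro!: continuous_intros continuous_on_subset[OF pullback_continuous[OF lp rm] O(2)])
  then have [measurable]: "(\<lambda>u. indicator O' u *\<^sub>R h u) \<in> borel_measurable borel"
    using O(1) by (intro borel_measurable_continuous_on_indicator) auto
  have ind: "ennreal (h u) * indicator O' u = ennreal (indicator O' u *\<^sub>R h u)" for u
    by (simp add: indicator_def)
  show ?thesis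
  proof (rule ccontr)
    assume "\<not> emeasure V (\<phi> ` O') > 0"
    then have "(\<integral>\<^sup>+u. ennreal (indicator O' u *\<^sub>R h u) \<partial>lborel) = 0" using eq unfolding ind by simp
    then have "AE u in lborel. ennreal (indicator O' u *\<^sub>R h u) = 0"
      by (subst (asm) nn_integral_0_iff_AE) measurable
    then have "AE u in lborel. u \<notin> O'"
    proof (rule AE_mp, intro AE_I2 impI notI)
      fix u assume "ennreal (indicator O' u *\<^sub>R h u) = 0" "u \<in> O'"
      moreover have "h u > 0" using gram_det_pos[OF lp rm, of u] \<open>u \<in> O'\<close> O(2) by (auto simp: h_def)
      ultimately show False by (simp add: ennreal_eq_0_iff)
    qed
    then have "O' \<in> null_sets lborel" using AE_iff_null_sets[of O' lborel] O(1) by simp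
    then have "negligible O'" by (simp add: negligible_iff_null_sets null_sets_completionI)
    then show False using open_not_negligible[OF O(1,3)] by simp
  qed
qed

text \<open>Nullity is first shown locally, because one \<open>L\<close> is injective only on a
  chart ball.\<close>

lemma definable_volume_null_near:
  fixes X :: "(real ^ 'n::finite) set"
  assumes om: "o_minimal M" and rs: "riemannian_submanifold TYPE('m::finite) X g"
    and V: "riemannian_volume TYPE('m) X g V"
    and D: "definable_set M D" "D \<subseteq> X" "\<And>l r. X \<inter> box l r \<noteq> {} \<Longrightarrow> \<not> X \<inter> box l r \<subseteq> D"
    and "x \<in> X"
  shows "\<exists>l r. x \<in> box l r \<and> emeasure V (D \<inter> box l r) = 0"
proof -
  obtain U and \<phi> :: "real ^ 'm \<Rightarrow> real ^ 'n" where lp: "local_parametrization X U \<phi>" and "x \<in> \<phi> ` U"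
    using rs \<open>x \<in> X\<close> unfolding riemannian_submanifold_def embedded_submanifold_def by blast
  then obtain u\<^sub>0 where u\<^sub>0: "u\<^sub>0 \<in> U" "x = \<phi> u\<^sub>0" by blast
  obtain s and L :: "real ^ 'n \<Rightarrow> real ^ 'm" where s: "s > 0" and L: "linear L" and sU: "cball u\<^sub>0 s \<subseteq> U"
    and bl: "\<And>u u'. u \<in> cball u\<^sub>0 s \<Longrightarrow> u' \<in> cball u\<^sub>0 s \<Longrightarrow> norm (u - u') \<le> 2 * norm (L (\<phi> u) - L (\<phi> u'))"
    using chart_bilipschitz[OF lp u\<^sub>0(1)] by blast
  let ?B = "ball u\<^sub>0 s"
  have BU: "?B \<subseteq> U" using sU by auto
  have inj: "u = u'" if "u \<in> ?B" "u' \<in> ?B" "L (\<phi> u) = L (\<phi> u')" for u u'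
    using bl[of u u'] that by auto
  have "openin (top_of_set X) (\<phi> ` ?B)" by (rule chart_image_openin[OF lp open_ball BU])
  then obtain W where W: "open W" "\<phi> ` ?B = X \<inter> W" unfolding openin_open by blast
  moreover have "x \<in> \<phi> ` ?B" using u\<^sub>0 s by auto
  ultimately obtain l r where lr: "box l r \<subseteq> W" "x \<in> box l r" by (metis IntD2 open_contains_box)
  \<comment> \<open>Cutting with a small box puts the set inside the chart image on which
    \<open>L\<close> is injective and keeps it definable.\<close>
  define A where "A = D \<inter> box l r"
  have AB: "A \<subseteq> \<phi> ` ?B" using W(2) lr(1) D(2) by (auto simp: A_def)
  have "interior (L ` A) = {}"
  proof (rule ccontr)
    assume "interior (L ` A) \<noteq> {}"
    then obtain z where z: "z \<in> interior (L ` A)" by blast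
    define O' where "O' = ?B \<inter> (\<lambda>u. L (\<phi> u)) -` interior (L ` A)"
    have "continuous_on ?B (\<lambda>u. L (\<phi> u))"
      using L by (intro bounded_linear.continuous_on[of L] continuous_on_subset[OF smooth_on_continuous[OF chart_smooth[OF lp]] BU])
        (simp add: linear_conv_bounded_linear)
    then have O: "open O'"
      unfolding O'_def by (intro continuous_open_preimage) auto
    have "z \<in> L ` A" using z interior_subset by blast
    then obtain u where "u \<in> ?B" "z = L (\<phi> u)" using AB by blast
    then have ne: "u \<in> O'" using z by (simp add: O'_def)
    have sub: "\<phi> ` O' \<subseteq> D"
    proof
      fix y assume "y \<in> \<phi> ` O'"
      then obtain w where w: "w \<in> ?B" "L (\<phi> w) \<in> interior (L ` A)" "y = \<phi> w" by (auto simp: O'_def)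
      then have "L (\<phi> w) \<in> L ` A" using interior_subset by blast
      then obtain a where a: "a \<in> A" "L (\<phi> w) = L a" by blast
      then obtain w' where "w' \<in> ?B" "a = \<phi> w'" using AB by blast
      then have "w = w'" using inj[of w w'] w(1) a(2) by simp
      then show "y \<in> D" using w(3) \<open>a = \<phi> w'\<close> a(1) by (simp add: A_def)
    qed
    have "openin (top_of_set X) (\<phi> ` O')"
      by (rule chart_image_openin[OF lp O]) (use BU in \<open>auto simp: O'_def\<close>)
    then obtain W' where W': "open W'" "\<phi> ` O' = X \<inter> W'" unfolding openin_open by blast
    moreover have "\<phi> u \<in> \<phi> ` O'" using ne by blast
    ultimately obtain l' r' where "box l' r' \<subseteq> W'" "\<phi> u \<in> box l' r'" "\<phi> u \<in> X"
      by (metis IntD1 IntD2 open_contains_box)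
    then show False using D(3)[of l' r'] W'(2) sub by blast
  qed
  then have "L ` A \<in> null_sets lborel"
    using linear_image_definable_null_or_interior[OF om D(1) L, of l r] unfolding A_def by blast
  then have neg: "negligible (L ` A)" by (simp add: negligible_iff_null_sets null_sets_completionI)
  define S where "S = U \<inter> \<phi> -` A"
  have SB: "S \<subseteq> ?B"
  proof
    fix u assume u: "u \<in> S"
    then obtain w where "w \<in> ?B" "\<phi> u = \<phi> w" using AB by (auto simp: S_def)
    then show "u \<in> ?B" using u BU chart_inj_on[OF lp] by (auto simp: S_def dest: inj_onD)
  qed
  define k where "k = (\<lambda>y. SOME u. u \<in> ?B \<and> L (\<phi> u) = y)"
  have k: "k y \<in> ?B \<and> L (\<phi> (k y)) = y" if "y \<in> L ` A" for y
    unfolding k_def by (rule someI_ex) (use that AB in blast)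
  have "negligible (k ` (L ` A))"
  proof (rule negligible_locally_Lipschitz_image[OF order_refl neg])
    fix y assume "y \<in> L ` A"
    then have "norm (k y' - k y) \<le> 2 * norm (y' - y)" if "y' \<in> L ` A" for y'
      using k[OF that] k[of y] bl[of "k y'" "k y"] by auto
    then show "\<exists>T B. open T \<and> y \<in> T \<and> (\<forall>y'\<in>L ` A \<inter> T. norm (k y' - k y) \<le> B * norm (y' - y))"
      by (intro exI[of _ UNIV] exI[of _ 2]) auto
  qed
  moreover have "S \<subseteq> k ` (L ` A)"
  proof
    fix u assume u: "u \<in> S"
    then have y: "L (\<phi> u) \<in> L ` A" by (auto simp: S_def)
    then have "u = k (L (\<phi> u))" using inj[of u "k (L (\<phi> u))"] k[OF y] SB u by auto
    then show "u \<in> k ` (L ` A)" using y by blast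
  qed
  ultimately have "negligible S" by (rule negligible_subset)
  \<comment> \<open>Negligibility refers to the completed measure, while the volume is an integral
    over \<open>lborel\<close>; an almost-everywhere statement passes between the two.\<close>
  then have "AE u in lebesgue. u \<notin> S" unfolding negligible_iff_null_sets by (rule AE_not_in)
  then have "AE u in lborel. u \<notin> S" by (simp only: AE_completion_iff)
  then have zero: "(\<integral>\<^sup>+u\<in>S. ennreal (sqrt (det (\<chi> i j. pullback_metric g \<phi> u (axis i 1) (axis j 1)))) \<partial>lborel) = 0"
  proof -
    let ?f = "\<lambda>u. ennreal (sqrt (det (\<chi> i j. pullback_metric g \<phi> u (axis i 1) (axis j 1))))"
    have "AE u in lborel. ?f u * indicator S u = 0"
      using \<open>AE u in lborel. u \<notin> S\<close> by eventually_elim simp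
    then have "(\<integral>\<^sup>+u\<in>S. ?f u \<partial>lborel) = (\<integral>\<^sup>+u. 0 \<partial>(lborel :: (real ^ 'm) measure))" by (rule nn_integral_cong_AE)
    also have "\<dots> = 0" by simp
    finally show ?thesis .
  qed
  have AV: "A \<in> sets V"
  proof -
    have "A \<in> sets borel" 
      unfolding A_def using definable_set_borel[OF om D(1)] by (rule sets.Int) simp
    moreover have "A = X \<inter> A" using D(2) by (auto simp: A_def)
    ultimately have "A \<in> sets (restrict_space borel X)" unfolding sets_restrict_space by (metis imageI)
    then show ?thesis using V unfolding riemannian_volume_def by (elim conjE) simp
  qed
  have AU: "A \<subseteq> \<phi> ` U" using AB BU by blast
  have "emeasure V A = 0"
    by (rule trans[OF riemannian_volume_chart[OF V lp AV AU] zero[unfolded S_def]])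
  then show ?thesis using lr(2) unfolding A_def by blast
qed

text \<open>A box contained in \<open>D\<close> over X contributes a nonempty open chart piece of
  positive volume. Conversely, a thin set is locally null, and Lindelof reduces it to countably many
  null pieces.\<close>

lemma definable_volume_null_iff:
  fixes X :: "(real ^ 'n::finite) set"
  assumes om: "o_minimal M" and rs: "riemannian_submanifold TYPE('m::finite) X g"
    and V: "riemannian_volume TYPE('m) X g V" and D: "definable_set M D" "D \<subseteq> X"
  shows "emeasure V D = 0 \<longleftrightarrow> \<not> (\<exists>l r. X \<inter> box l r \<noteq> {} \<and> X \<inter> box l r \<subseteq> D)"
proof
  have setsV: "sets V = sets (restrict_space borel X)" using V unfolding riemannian_volume_def by blast
  have DV: "D \<in> sets V"
    unfolding setsV sets_restrict_space using definable_set_borel[OF om D(1)] D(2) by blast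
  {
    assume 0: "emeasure V D = 0"
    show "\<not> (\<exists>l r. X \<inter> box l r \<noteq> {} \<and> X \<inter> box l r \<subseteq> D)"
    proof
      assume "\<exists>l r. X \<inter> box l r \<noteq> {} \<and> X \<inter> box l r \<subseteq> D"
      then obtain l r x where x: "x \<in> X" "x \<in> box l r" and sub: "X \<inter> box l r \<subseteq> D" by blast
      obtain U and \<phi> :: "real ^ 'm \<Rightarrow> real ^ 'n" where lp: "local_parametrization X U \<phi>" and xU: "x \<in> \<phi> ` U"
        using rs x(1) unfolding riemannian_submanifold_def embedded_submanifold_def by blast
      define O' where "O' = U \<inter> \<phi> -` box l r"
      have "open O'"
        unfolding O'_def
        by (intro continuous_open_preimage smooth_on_continuous chart_smooth[OF lp] chart_open[OF lp] open_box)
      then have "emeasure V (\<phi> ` O') > 0"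
        using rs xU x(2) unfolding riemannian_submanifold_def
        by (intro volume_chart_image_pos[OF lp _ V]) (auto simp: O'_def)
      moreover have "\<phi> ` O' \<subseteq> D" using sub chart_subset[OF lp] by (auto simp: O'_def)
      ultimately show False using 0 emeasure_mono[OF _ DV] by (metis not_less)
    qed
  }
  assume thin: "\<not> (\<exists>l r. X \<inter> box l r \<noteq> {} \<and> X \<inter> box l r \<subseteq> D)"
  \<comment> \<open>The relatively open pieces of X on which \<open>D\<close> is null. They cover X
    by the local lemma.\<close>
  define \<F> where "\<F> = {X \<inter> box l r |l r. emeasure V (D \<inter> box l r) = 0}"
  have "openin (top_of_set X) S" if "S \<in> \<F>" for S using that by (auto simp: \<F>_def openin_open)
  then obtain \<F>' where F': "\<F>' \<subseteq> \<F>" "countable \<F>'" "\<Union>\<F>' = \<Union>\<F>" by (rule Lindelof_openin)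
  have "X \<subseteq> \<Union>\<F>"
  proof
    fix x assume "x \<in> X"
    then obtain l r where "x \<in> box l r" "emeasure V (D \<inter> box l r) = 0"
      using definable_volume_null_near[OF om rs V D, of x] thin by blast
    then show "x \<in> \<Union>\<F>" using \<open>x \<in> X\<close> by (auto simp: \<F>_def)
  qed
  then have "D = (\<Union>S\<in>\<F>'. D \<inter> S)" using F'(3) D(2) by blast
  moreover have "(\<Union>S\<in>\<F>'. D \<inter> S) \<in> null_sets V"
  proof (rule null_sets_UN'[OF F'(2)])
    fix S assume "S \<in> \<F>'"
    then obtain l r where S: "S = X \<inter> box l r" "emeasure V (D \<inter> box l r) = 0"
      using F'(1) by (auto simp: \<F>_def)
    have "D \<inter> S = D \<inter> box l r" using S(1) D(2) by blast
    moreover have "X \<inter> box l r \<in> sets V"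
      unfolding setsV by (rule openin_sets_restrict_borel) (auto simp: openin_open)
    then have "D \<inter> S \<in> sets V" using DV S(1) by blast
    ultimately show "D \<inter> S \<in> null_sets V" using S(2) by (simp add: null_sets_def)
  qed
  ultimately show "emeasure V D = 0" by auto
qed

text \<open>The required formula says that some box corners exist for which the box meets X and all
  its points in X satisfy \<phi>. Since membership in X is expressed through \<open>d\<close>, no
  parameters are introduced.\<close>

lemma thickness_definable_of_boxes:
  fixes X :: "(real ^ 'n::finite) set"
  assumes def: "definable_without_parameters M 2 {c \<in> {..<2} \<rightarrow>\<^sub>E X. d (c 0) (c 1) < 1}"
    and d0: "\<And>x. x \<in> X \<Longrightarrow> d x x = 0"
    and thick: "\<And>A. A \<subseteq> X \<Longrightarrow> thick X d A \<longleftrightarrow> (\<exists>l r. X \<inter> box l r \<noteq> {} \<and> X \<inter> box l r \<subseteq> A)"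
  shows "thickness_definable M X d"
  unfolding thickness_definable_def
proof (intro allI impI)
  fix k and \<phi>
  define n where "n = CARD('n)"
  have n: "n > 0" by (simp add: n_def)
  assume "wf_fm M \<phi> \<and> fv_fm \<phi> \<subseteq> {..<(1 + k) * CARD('n)}"
  then have \<phi>: "wf_fm M \<phi>" "fv_fm \<phi> \<subseteq> {..<(1 + k) * n}" by (auto simp: n_def)
  obtain p where p: "wf_fm M p" "fv_fm p \<subseteq> {..<2 * n}"
    and eq: "{c \<in> {..<2} \<rightarrow>\<^sub>E X. d (c 0) (c 1) < 1} = {c \<in> {..<2} \<rightarrow>\<^sub>E UNIV. sat M (coords c) p}"
    using def unfolding definable_without_parameters_def n_def by (elim exE conjE)
  \<comment> \<open>The second point is quantified instead of being identified with the first, since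
    renamings must be injective; a point of X is its own witness.\<close>
  define inX where "inX = (\<lambda>e. \<exists>f. sat M (\<lambda>v. if v \<in> {n..<2 * n} then f v else e v) p)"
  have inX: "formula_pred M inX"
    unfolding inX_def by (intro formula_pred.ex_block[of _ M "\<lambda>e. sat M e p"] formula_pred_sat p(1)) auto
  have inX_iff: "inX e \<longleftrightarrow> x \<in> X" if e: "\<And>v. v < n \<Longrightarrow> e v = x $ index v" for e x
  proof
    assume "inX e"
    then obtain f where f: "sat M (\<lambda>v. if v \<in> {n..<2 * n} then f v else e v) p" unfolding inX_def by blast
    obtain y :: "real ^ 'n" where y: "\<forall>v<n. y $ index v = f (n + v)"
      using ex_vec_index[of "\<lambda>v. f (n + v)"] n_def by blast
    define c where "c = (\<lambda>i\<in>{..<2::nat}. if i = 0 then x else y)"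
    have cc: "coords c v = (if v \<in> {n..<2 * n} then f v else e v)" if "v < 2 * n" for v
    proof (cases "v < n")
      case True
      then show ?thesis using e coords_index(1)[of v c] by (simp add: c_def n_def)
    next
      case False
      define w where "w = v - n"
      have "v = n + w" "w < n" using False that by (auto simp: w_def)
      then show ?thesis using y coords_index(2)[of w c] by (simp add: c_def n_def)
    qed
    have "sat M (coords c) p = sat M (\<lambda>v. if v \<in> {n..<2 * n} then f v else e v) p"
      by (rule sat_cong, rule cc) (use p(2) in auto)
    then have "sat M (coords c) p" using f by simp
    then have "c \<in> {c \<in> {..<2} \<rightarrow>\<^sub>E X. d (c 0) (c 1) < 1}" unfolding eq by (auto simp: c_def)
    then have "c \<in> {..<2} \<rightarrow>\<^sub>E X" by simp
    then have "c 0 \<in> X" by (rule PiE_mem) simp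
    then show "x \<in> X" by (simp add: c_def)
  next
    assume x: "x \<in> X"
    define c where "c = (\<lambda>i\<in>{..<2::nat}. x)"
    have "c \<in> {..<2} \<rightarrow>\<^sub>E X" using x by (auto simp: c_def)
    moreover have "d (c 0) (c 1) < 1" using d0[OF x] by (simp add: c_def)
    ultimately have "c \<in> {c \<in> {..<2} \<rightarrow>\<^sub>E UNIV. sat M (coords c) p}" unfolding eq[symmetric] by simp
    then have "sat M (coords c) p" by simp
    have cc: "coords c v = (if v \<in> {n..<2 * n} then coords c v else e v)" if "v < 2 * n" for v
    proof (cases "v < n")
      case True
      have "c 0 = x" by (simp add: c_def)
      then have "coords c v = e v" using e[OF True] coords_index(1)[of v c] True unfolding n_def by (simp only:)
      then show ?thesis by simp
    next
      case False
      then show ?thesis using that by simp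
    qed
    have "sat M (coords c) p = sat M (\<lambda>v. if v \<in> {n..<2 * n} then coords c v else e v) p"
      by (rule sat_cong, rule cc) (use p(2) in auto)
    then have "sat M (\<lambda>v. if v \<in> {n..<2 * n} then coords c v else e v) p"
      using \<open>sat M (coords c) p\<close> by (rule iffD1)
    then show "inX e" unfolding inX_def by blast
  qed
  \<comment> \<open>Layout of the variables: the point x below \<open>n\<close>, the arguments y of
    \<psi> from \<open>n\<close> to \<open>N - 1\<close>, then \<open>n\<close> coordinates each for
    the lower and the upper corner.\<close>
  define N where "N = (1 + k) * n"
  define B where "B = (\<lambda>e. inX e \<and> (\<forall>j\<in>{..<n}. e (N + j) < e j \<and> e j < e (N + n + j)))"
  have B: "formula_pred M B"
    unfolding B_def by (intro formula_pred.conj inX formula_pred.ball formula_pred.less finite_lessThan)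
  define T0 where "T0 = (\<lambda>e. (\<exists>f. B (\<lambda>v. if v \<in> {..<n} then f v else e v)) \<and>
     (\<forall>f. B (\<lambda>v. if v \<in> {..<n} then f v else e v) \<longrightarrow> sat M (\<lambda>v. if v \<in> {..<n} then f v else e v) \<phi>))"
  have T0: "formula_pred M T0"
    unfolding T0_def
    by (intro formula_pred.conj formula_pred.ex_block B finite_lessThan
        formula_pred.all_block[of _ M "\<lambda>e. B e \<longrightarrow> sat M e \<phi>"] formula_pred.imp formula_pred_sat \<phi>(1))
  define T where "T = (\<lambda>e. \<exists>h. T0 (\<lambda>v. if v \<in> {N..<N + 2 * n} then h v else e v))"
  have T: "formula_pred M T" unfolding T_def by (intro formula_pred.ex_block T0) auto
  have T_iff: "T e \<longleftrightarrow> (\<exists>l r. X \<inter> box l r \<noteq> {} \<and> X \<inter> box l r \<subseteq> {x \<in> X. sat M (coords (case_nat x b)) \<phi>})"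
    if e: "\<And>v. v < k * n \<Longrightarrow> e (n + v) = coords b v" for e and b :: "nat \<Rightarrow> real ^ 'n"
  proof -
    have main: "T0 (\<lambda>v. if v \<in> {N..<N + 2 * n} then h v else e v) \<longleftrightarrow>
        X \<inter> box l r \<noteq> {} \<and> X \<inter> box l r \<subseteq> {x \<in> X. sat M (coords (case_nat x b)) \<phi>}"
      if l: "\<And>v. v < n \<Longrightarrow> l $ index v = h (N + v)" and r: "\<And>v. v < n \<Longrightarrow> r $ index v = h (N + n + v)" for h l r
    proof -
      define E where "E = (\<lambda>f :: nat \<Rightarrow> real. \<lambda>v. if v \<in> {..<n} then f v else if v \<in> {N..<N + 2 * n} then h v else e v)"
      have nN: "n \<le> N" by (simp add: N_def)
      have BE: "B (E f) \<longleftrightarrow> x \<in> X \<inter> box l r" if x: "\<And>v. v < n \<Longrightarrow> x $ index v = f v" for f x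
      proof -
        have "inX (E f) \<longleftrightarrow> x \<in> X" by (rule inX_iff) (simp add: E_def x)
        moreover have "(\<forall>j\<in>{..<n}. E f (N + j) < E f j \<and> E f j < E f (N + n + j)) \<longleftrightarrow> x \<in> box l r"
          unfolding mem_box_index n_def[symmetric] using nN x l r by (auto simp: E_def)
        ultimately show ?thesis unfolding B_def by simp
      qed
      have satE: "sat M (E f) \<phi> \<longleftrightarrow> sat M (coords (case_nat x b)) \<phi>" if x: "\<And>v. v < n \<Longrightarrow> x $ index v = f v" for f x
      proof (rule sat_cong)
        fix v assume "v \<in> fv_fm \<phi>"
        then have v: "v < N" using \<phi>(2) by (auto simp: N_def)
        show "E f v = coords (case_nat x b) v"
        proof (cases "v < n")
          case True
          then show ?thesis using x by (simp add: E_def coords_def n_def)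
        next
          case False
          then obtain w where w: "v = n + w" by (metis le_iff_add not_less)
          then have "w < k * n" using v by (simp add: N_def)
          moreover have "coords (case_nat x b) (n + w) = coords b w"
            by (simp add: coords_def n_def)
          ultimately show ?thesis using w v e by (simp add: E_def)
        qed
      qed
      have ex: "\<exists>x :: real ^ 'n. \<forall>v<n. x $ index v = f v" for f using ex_vec_index n_def by blast
      have "T0 (\<lambda>v. if v \<in> {N..<N + 2 * n} then h v else e v) \<longleftrightarrow>
        (\<exists>f. B (E f)) \<and> (\<forall>f. B (E f) \<longrightarrow> sat M (E f) \<phi>)"
        unfolding T0_def E_def ..
      also have "\<dots> \<longleftrightarrow> (\<exists>x. x \<in> X \<inter> box l r) \<and> (\<forall>x. x \<in> X \<inter> box l r \<longrightarrow> sat M (coords (case_nat x b)) \<phi>)"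
      proof -
        have "(\<exists>f. Z f) \<longleftrightarrow> (\<exists>x :: real ^ 'n. Z' x)"
          if "\<And>f x. \<forall>v<n. x $ index v = f v \<Longrightarrow> Z f \<longleftrightarrow> Z' x" for Z :: "(nat \<Rightarrow> real) \<Rightarrow> bool" and Z'
        proof
          assume "\<exists>f. Z f"
          then obtain f where "Z f" by blast
          moreover obtain x :: "real ^ 'n" where "\<forall>v<n. x $ index v = f v" using ex by blast
          ultimately show "\<exists>x. Z' x" using that by blast
        next
          assume "\<exists>x. Z' x"
          then obtain x where "Z' x" by blast
          then have "Z (\<lambda>v. x $ index v)" using that[of x "\<lambda>v. x $ index v"] by simp
          then show "\<exists>f. Z f" by blast
        qed
        note tr = this
        have 1: "(\<exists>f. B (E f)) \<longleftrightarrow> (\<exists>x. x \<in> X \<inter> box l r)"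
          by (rule tr) (use BE in blast)
        have 2: "(\<exists>f. B (E f) \<and> \<not> sat M (E f) \<phi>) \<longleftrightarrow> (\<exists>x. x \<in> X \<inter> box l r \<and> \<not> sat M (coords (case_nat x b)) \<phi>)"
          by (rule tr) (use BE satE in blast)
        show ?thesis using 1 2 by blast
      qed
      finally show ?thesis by blast
    qed
    have vec: "\<exists>x :: real ^ 'n. \<forall>v<n. x $ index v = f v" for f using ex_vec_index n_def by blast
    show ?thesis
    proof
      assume "T e"
      then obtain h where h: "T0 (\<lambda>v. if v \<in> {N..<N + 2 * n} then h v else e v)" unfolding T_def by blast
      obtain l r :: "real ^ 'n" where "\<forall>v<n. l $ index v = h (N + v)" "\<forall>v<n. r $ index v = h (N + n + v)"
        using vec[of "\<lambda>v. h (N + v)"] vec[of "\<lambda>v. h (N + n + v)"] by blast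
      then show "\<exists>l r. X \<inter> box l r \<noteq> {} \<and> X \<inter> box l r \<subseteq> {x \<in> X. sat M (coords (case_nat x b)) \<phi>}"
        using main[of l h r] h by blast
    next
      assume "\<exists>l r. X \<inter> box l r \<noteq> {} \<and> X \<inter> box l r \<subseteq> {x \<in> X. sat M (coords (case_nat x b)) \<phi>}"
      then obtain l r where lr: "X \<inter> box l r \<noteq> {} \<and> X \<inter> box l r \<subseteq> {x \<in> X. sat M (coords (case_nat x b)) \<phi>}" by blast
      define h where "h = (\<lambda>v. if v < N + n then l $ index (v - N) else r $ index (v - N - n))"
      have "T0 (\<lambda>v. if v \<in> {N..<N + 2 * n} then h v else e v)"
        by (subst main[of l h r]) (use lr in \<open>auto simp: h_def\<close>)
      then show "T e" unfolding T_def by blast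
    qed
  qed
  \<comment> \<open>Moves the arguments y down to start at 0 as \<psi> requires. The block of x goes
    to the gap above them, so that the renaming is a permutation.\<close>
  define \<sigma> :: "nat \<Rightarrow> nat" where "\<sigma> = (\<lambda>v. if v < n then v + k * n else if v < N then v - n else v)"
  have "inj \<sigma>" unfolding \<sigma>_def N_def inj_def by (auto split: if_splits)
  then have T': "formula_pred M (\<lambda>e. T (e \<circ> \<sigma>))" by (rule formula_pred_rename[OF T])
  have T'_iff: "T (e \<circ> \<sigma>) \<longleftrightarrow> (\<exists>l r. X \<inter> box l r \<noteq> {} \<and> X \<inter> box l r \<subseteq> {x \<in> X. sat M (coords (case_nat x b)) \<phi>})"
    if "\<And>v. v < k * n \<Longrightarrow> e v = coords b v" for e and b :: "nat \<Rightarrow> real ^ 'n"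
    by (rule T_iff) (simp add: \<sigma>_def N_def that)
  have "\<exists>\<psi>. wf_fm M \<psi> \<and> fv_fm \<psi> \<subseteq> {..<k * n} \<and> (\<forall>e. sat M e \<psi> = T (e \<circ> \<sigma>))"
  proof (rule formula_pred_fv[OF T'])
    fix e e' :: "nat \<Rightarrow> real" assume ee: "\<And>v. v \<in> {..<k * n} \<Longrightarrow> e v = e' v"
    \<comment> \<open>Every assignment is \<open>coords b\<close> for some sequence of points. Then
      \<open>e\<close> and \<open>e'\<close> both agree with \<open>coords b\<close> on the
      arguments, so both truth values equal the condition on boxes for \<open>b\<close>.\<close>
    have "\<exists>b :: nat \<Rightarrow> real ^ 'n. \<forall>i. \<forall>v<CARD('n). b i $ index v = e (i * n + v)"
    proof (rule choice, rule allI)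
      fix i
      show "\<exists>x :: real ^ 'n. \<forall>v<CARD('n). x $ index v = e (i * n + v)" by (rule ex_vec_index)
    qed
    then obtain b :: "nat \<Rightarrow> real ^ 'n" where b: "\<And>i v. v < n \<Longrightarrow> b i $ index v = e (i * n + v)"
      unfolding n_def by blast
    have "coords b v = e v" for v
      unfolding coords_def n_def[symmetric] using b[of "v mod n" "v div n"] n by simp
    then show "T (e \<circ> \<sigma>) = T (e' \<circ> \<sigma>)" using ee by (simp add: T'_iff[of _ b])
  qed
  then obtain \<psi> where \<psi>: "wf_fm M \<psi>" "fv_fm \<psi> \<subseteq> {..<k * n}" "\<And>e. sat M e \<psi> = T (e \<circ> \<sigma>)" by blast
  have "sat M (coords b) \<psi> \<longleftrightarrow> thick X d {x \<in> X. sat M (coords (case_nat x b)) \<phi>}" for b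
    unfolding \<psi>(3) by (subst thick) (auto simp only: T'_iff[of "coords b" b])
  then show "\<exists>\<psi>. wf_fm M \<psi> \<and> fv_fm \<psi> \<subseteq> {..<k * CARD('n)} \<and>
      (\<forall>b\<in>{..<k} \<rightarrow>\<^sub>E X. sat M (coords b) \<psi> = thick X d {x \<in> X. sat M (coords (case_nat x b)) \<phi>})"
    using \<psi>(1,2) unfolding n_def by blast
qed

theorem proposition3p15:
  fixes X :: "(real ^ 'n::finite) set"
    and g :: "real ^ 'n \<Rightarrow> real ^ 'n \<Rightarrow> real ^ 'n \<Rightarrow> real"
    and R :: "('f, 'r) real_structure"
  defines "d \<equiv> geodesic_dist X g"
  assumes "riemannian_submanifold TYPE('m::finite) X g"
    and "\<forall>x\<in>X. \<forall>y\<in>X. geodesic_edist X g x y < \<infinity>"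
    and "separable_metric_no_isolated X d"
    and "o_minimal R"
    and "countable_language R"
    and "definable_set R X"
    and "definable_without_parameters R 2 {c \<in> {..<2} \<rightarrow>\<^sub>E X. d (c 0) (c 1) < 1}"
  shows "thickness_definable R X d \<and>
    (\<forall>V \<mu>. riemannian_volume TYPE('m) X g V \<and>
            prob_space \<mu> \<and> sets \<mu> = sets (restrict_space borel X) \<and>
            (\<forall>A \<in> sets (restrict_space borel X). emeasure \<mu> A > 0 \<longleftrightarrow> emeasure V A > 0) \<longrightarrow>
            compatible R X d \<mu>)"
proof -
  have ms: "Metric_space X d" using assms(4) unfolding separable_metric_no_isolated_def by blast
  have thick: "thick X d A \<longleftrightarrow> (\<exists>l r. X \<inter> box l r \<noteq> {} \<and> X \<inter> box l r \<subseteq> A)" if "A \<subseteq> X" for A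
    unfolding d_def by (rule thick_iff_box[OF assms(2,3) ms[unfolded d_def] that])
  have "compatible R X d \<mu>"
    if V: "riemannian_volume TYPE('m) X g V" and "prob_space \<mu>" and sets: "sets \<mu> = sets (restrict_space borel X)"
      and equiv: "\<forall>A \<in> sets (restrict_space borel X). emeasure \<mu> A > 0 \<longleftrightarrow> emeasure V A > 0" for V \<mu>
  proof -
    interpret prob_space \<mu> by fact
    have "measure \<mu> D = 0 \<longleftrightarrow> \<not> thick X d D" if D: "D \<subseteq> X" "definable_set R D" for D
    proof -
      have "D \<in> sets (restrict_space borel X)"
        unfolding sets_restrict_space using definable_set_borel[OF assms(5) D(2)] D(1) by blast
      then have "emeasure \<mu> D = 0 \<longleftrightarrow> emeasure V D = 0" using equiv by (metis not_gr_zero)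
      then show ?thesis
        using definable_volume_null_iff[OF assms(5,2) V D(2,1)] thick[OF D(1)]
        by (simp add: emeasure_eq_measure)
    qed
    then show ?thesis
      unfolding compatible_def using definable_measurable[OF assms(5) sets] by blast
  qed
  moreover have "thickness_definable R X d"
    by (rule thickness_definable_of_boxes[OF assms(8) _ thick]) (simp add: Metric_space.mdist_zero[OF ms])
  ultimately show ?thesis by blast
qed

end
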